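(* Let $\alpha>0$ and $\beta>1$. Let $u$ be a smooth positive solution to $$u_t=\Delta(u^\beta)\ \text{ in }\Omega,\ t>0,\qquad \nabla(u^\beta)\cdot\nu=0\ \text{ on }\partial\Omega,\ t>0,\qquad u(\cdot,0)=u_0\ \text{ in }\Omega,$$ where $u_0\in L^\infty(\Omega)$ with $\inf_\Omega u_0\ge 0$. Then $$E_\alpha[u(t)]\le\frac{1}{(C_1t+C_2)^{(\alpha+1)/(\beta-1)}},\qquad t\ge 0,$$ where $$C_1=\frac{4\alpha\beta(\beta-1)}{(\alpha+1)(\alpha+\beta)^2}\left(\frac{\alpha+1}{C_B(p,q)}\right)^{(\alpha+\beta)/(\alpha+1)},\qquad C_2=E_\alpha[u_0]^{-(\beta-1)/(\alpha+1)},$$ with $p=(\alpha+\beta)/2$, $q=2(\alpha+1)/(\alpha+\beta)$ and $C_B(p,q)=\dfrac{2(pq-1)C_P^q}{2-q}$.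
   Context: $\Omega\subset\mathbb{R}^d$ ($d\ge1$) is a bounded domain with Lebesgue measure $\mathrm{m}(\Omega)=1$, with unit exterior normal $\nu$ on $\partial\Omega$, such that the Poincaré-Wirtinger inequality $\|f-\bar f\|_{L^2(\Omega)}\le C_P\|\nabla f\|_{L^2(\Omega)}$ holds for all $f\in H^1(\Omega)$, where $\bar f=\int_\Omega f\,dx$ and $C_P>0$ depends only on $d$ and $\Omega$. The zeroth-order entropy is $$E_\alpha[u]=\frac{1}{\alpha+1}\left(\int_\Omega u^{\alpha+1}\,dx-\Big(\int_\Omega u\,dx\Big)^{\alpha+1}\right).$$ Throughout, solutions are assumed smooth and positive, so that all computations and integrations by parts are justified (including up to the initial time $t=0$). If $E_\alpha[u_0]=0$, then $C_2=+\infty$ and the right-hand side of the estimate is understood as $0$. *)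

theory Defs
  imports "HOL-Analysis.Analysis"
begin

(* The derivatives are taken within S, so that for an open S this is the usual class C^k(S), while
   for the closure of a domain with C^1 boundary (where derivatives within the closure are unique)
   it is the class of C^k functions whose derivatives extend continuously up to the boundary. *)
primrec C_k_on :: "nat \<Rightarrow> 'a::euclidean_space set \<Rightarrow> ('a \<Rightarrow> real) \<Rightarrow> bool" where
  "C_k_on 0 S f \<longleftrightarrow> continuous_on S f"
| "C_k_on (Suc k) S f \<longleftrightarrow>
     (\<exists>f'. (\<forall>x\<in>S. (f has_derivative f' x) (at x within S)) \<and> (\<forall>v. C_k_on k S (\<lambda>x. f' x v)))"

definition smooth_on :: "'a::euclidean_space set \<Rightarrow> ('a \<Rightarrow> real) \<Rightarrow> bool" where
  "smooth_on S f \<longleftrightarrow> (\<forall>k. C_k_on k S f)"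

definition gradient_within :: "('a::euclidean_space \<Rightarrow> real) \<Rightarrow> 'a set \<Rightarrow> 'a \<Rightarrow> 'a" where
  "gradient_within f S x = (\<Sum>b\<in>Basis. frechet_derivative f (at x within S) b *\<^sub>R b)"

definition laplacian :: "('a::euclidean_space \<Rightarrow> real) \<Rightarrow> 'a \<Rightarrow> real" where
  "laplacian f x = (\<Sum>b\<in>Basis. frechet_derivative (\<lambda>y. frechet_derivative f (at y) b) (at x) b)"

(* n is the unit exterior normal at the boundary point x: near x, up to cones of arbitrarily small
   opening around the tangent hyperplane, the set is the half-space {y. n . (y - x) < 0}. *)
definition exterior_unit_normal_at :: "'a::euclidean_space set \<Rightarrow> 'a \<Rightarrow> 'a \<Rightarrow> bool" where
  "exterior_unit_normal_at \<Omega> x n \<longleftrightarrow> norm n = 1 \<and>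
     (\<forall>e>0. \<exists>r>0. \<forall>y\<in>ball x r.
        (n \<bullet> (y - x) < - e * norm (y - x) \<longrightarrow> y \<in> \<Omega>) \<and>
        (n \<bullet> (y - x) > e * norm (y - x) \<longrightarrow> y \<notin> \<Omega>))"

(* For an open set, existence of a continuous exterior unit normal field on the whole boundary
   says that the set is locally the region below the graph of a C^1 function. *)
definition exterior_unit_normal_field :: "'a::euclidean_space set \<Rightarrow> ('a \<Rightarrow> 'a) \<Rightarrow> bool" where
  "exterior_unit_normal_field \<Omega> \<nu> \<longleftrightarrow>
     continuous_on (frontier \<Omega>) \<nu> \<and> (\<forall>x\<in>frontier \<Omega>. exterior_unit_normal_at \<Omega> x (\<nu> x))"

definition bounded_domain :: "'a::euclidean_space set \<Rightarrow> bool" where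
  "bounded_domain \<Omega> \<longleftrightarrow> open \<Omega> \<and> connected \<Omega> \<and> \<Omega> \<noteq> {} \<and> bounded \<Omega>"

definition square_integrable_on ::
    "('a::euclidean_space \<Rightarrow> 'b::euclidean_space) \<Rightarrow> 'a set \<Rightarrow> bool" where
  "square_integrable_on f \<Omega> \<longleftrightarrow>
     f \<in> borel_measurable (lebesgue_on \<Omega>) \<and> integrable (lebesgue_on \<Omega>) (\<lambda>x. (norm (f x))\<^sup>2)"

definition L2norm_on :: "'a::euclidean_space set \<Rightarrow> ('a \<Rightarrow> 'b::euclidean_space) \<Rightarrow> real" where
  "L2norm_on \<Omega> f = sqrt (\<integral>x. (norm (f x))\<^sup>2 \<partial>lebesgue_on \<Omega>)"

definition test_function :: "'a::euclidean_space set \<Rightarrow> ('a \<Rightarrow> real) \<Rightarrow> bool" where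
  "test_function \<Omega> \<phi> \<longleftrightarrow>
     smooth_on UNIV \<phi> \<and> (\<exists>K. compact K \<and> K \<subseteq> \<Omega> \<and> (\<forall>x. x \<notin> K \<longrightarrow> \<phi> x = 0))"

definition has_weak_gradient ::
    "('a::euclidean_space \<Rightarrow> real) \<Rightarrow> ('a \<Rightarrow> 'a) \<Rightarrow> 'a set \<Rightarrow> bool" where
  "has_weak_gradient f g \<Omega> \<longleftrightarrow>
     (\<forall>\<phi> b. test_function \<Omega> \<phi> \<and> b \<in> Basis \<longrightarrow>
        (\<integral>x. f x * frechet_derivative \<phi> (at x) b \<partial>lebesgue_on \<Omega>)
          = - (\<integral>x. (g x \<bullet> b) * \<phi> x \<partial>lebesgue_on \<Omega>))"

(* f ranges over H^1(\<Omega>), together with its weak gradient g, which is unique almost everywhere.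
   The mean value is the integral because the domain will have measure 1. *)
definition poincare_wirtinger :: "'a::euclidean_space set \<Rightarrow> real \<Rightarrow> bool" where
  "poincare_wirtinger \<Omega> C \<longleftrightarrow>
     (\<forall>f g. square_integrable_on f \<Omega> \<and> square_integrable_on g \<Omega> \<and> has_weak_gradient f g \<Omega> \<longrightarrow>
        L2norm_on \<Omega> (\<lambda>x. f x - (\<integral>y. f y \<partial>lebesgue_on \<Omega>)) \<le> C * L2norm_on \<Omega> g)"

definition entropy :: "'a::euclidean_space set \<Rightarrow> real \<Rightarrow> ('a \<Rightarrow> real) \<Rightarrow> real" where
  "entropy \<Omega> \<alpha> v = 1 / (\<alpha> + 1) *
     ((\<integral>x. v x powr (\<alpha> + 1) \<partial>lebesgue_on \<Omega>) - (\<integral>x. v x \<partial>lebesgue_on \<Omega>) powr (\<alpha> + 1))"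

definition bounded_nonneg_datum :: "'a::euclidean_space set \<Rightarrow> ('a \<Rightarrow> real) \<Rightarrow> bool" where
  "bounded_nonneg_datum \<Omega> u0 \<longleftrightarrow>
     u0 \<in> borel_measurable (lebesgue_on \<Omega>) \<and>
     (\<exists>M. AE x in lebesgue_on \<Omega>. \<bar>u0 x\<bar> \<le> M) \<and>
     (AE x in lebesgue_on \<Omega>. 0 \<le> u0 x)"

(* u t x is the solution at time t. It is smooth and positive up to the boundary for t > 0; at
   t = 0 only continuity is required, so that the initial datum may have zeros. *)
definition smooth_positive_solution ::
    "'a::euclidean_space set \<Rightarrow> ('a \<Rightarrow> 'a) \<Rightarrow> real \<Rightarrow> ('a \<Rightarrow> real) \<Rightarrow> (real \<Rightarrow> 'a \<Rightarrow> real) \<Rightarrow> bool" where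
  "smooth_positive_solution \<Omega> \<nu> \<beta> u0 u \<longleftrightarrow>
     smooth_on ({0<..} \<times> closure \<Omega>) (\<lambda>(t, x). u t x) \<and>
     continuous_on ({0..} \<times> closure \<Omega>) (\<lambda>(t, x). u t x) \<and>
     (\<forall>t>0. \<forall>x\<in>closure \<Omega>. 0 < u t x) \<and>
     (\<forall>t>0. \<forall>x\<in>\<Omega>.
        ((\<lambda>s. u s x) has_real_derivative laplacian (\<lambda>y. u t y powr \<beta>) x) (at t)) \<and>
     (\<forall>t>0. \<forall>x\<in>frontier \<Omega>.
        gradient_within (\<lambda>y. u t y powr \<beta>) (closure \<Omega>) x \<bullet> \<nu> x = 0) \<and>
     (\<forall>x\<in>\<Omega>. u 0 x = u0 x)"

definition beckner_const :: "real \<Rightarrow> real \<Rightarrow> real \<Rightarrow> real" where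
  "beckner_const C\<^sub>P p q = 2 * (p * q - 1) * C\<^sub>P powr q / (2 - q)"

end

theory Submission
  imports Defs
begin

text \<open>
  Along the flow the mass is conserved and $E' = -\alpha\beta\int u^{\alpha+\beta-2}|\nabla u|^2
  = -(\alpha\beta/p^2)\,\|\nabla u^p\|_2^2$. The Beckner inequality
  $(\alpha+1)E \le C_B \|\nabla u^p\|_2^q$ turns this into $E' \le -k E^{1+\delta}$ with
  $\delta = (\beta-1)/(\alpha+1)$, so $E^{-\delta}$ grows at least linearly.

  The Beckner inequality follows from the Poincare-Wirtinger inequality for $f = u^p$ by
  Hoelder: $\|f\|_1^2 \le \|f\|_q^q \|f\|_2^{2-q}$ yields
  $\|f\|_2^q - \|f\|_q^q \le (\|f\|_2^2 - \|f\|_1^2)^{q/2}$, and interpolating $L^q$ between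
  $L^{1/p}$ and $L^2$ bounds $\|f\|_q^q - \|f\|_{1/p}^q$ by a multiple of the left-hand side.

  The integrations by parts rest on $\int_\Omega \mathrm{div}\, F = 0$ for fields $F$ tangential to
  the boundary. If $y$ is a boundary point nearest to $x \in \Omega$, then
  $x - y = -|x-y|\nu(y)$, so $|F(x)\cdot\nu(y)| \le L|x-y|$. Testing with a cutoff depending on the
  distance to the boundary, the boundary layer contributes a bounded integrand
  supported on a shrinking set, and neither the regularity of the distance nor the surface
  measure of the boundary matters.
\<close>

section \<open>The Beckner inequality\<close>

text \<open>The squared distance \<open>D\<close> to the complement of \<Omega> need not be
  differentiable, but it is semiconcave: the boundary point nearest to x is a competitor for x + w,
  so D(x + w) exceeds D(x) by at most a linear term in w plus |w|^2. This one-sided bound shapes the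
  divergence argument. Derivatives of the cutoff are replaced by difference quotients with a step h,
  the cutoff is a concave increasing function of \<open>D\<close> with a scale e, and only an
  inequality for the integral of the divergence results; equality comes from applying it to -F as
  well. The choice h = e^2 makes the second-order error h / e vanish.

  At time 0 the solution is merely continuous and may have zeros. The differential identities are
  therefore used at positive times only, and the initial value enters through the continuity of the
  entropy.\<close>

lemma integral_powr_mult_powr_le:
  fixes f g :: "'b \<Rightarrow> real"
  assumes f: "integrable M f" and g: "integrable M g"
    and fpos: "\<And>x. x \<in> space M \<Longrightarrow> 0 < f x" and gpos: "\<And>x. x \<in> space M \<Longrightarrow> 0 < g x"
    and "0 < (\<integral>x. f x \<partial>M)" "0 < (\<integral>x. g x \<partial>M)" and "0 \<le> a" "0 \<le> b" "a + b = 1"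
    and fg: "integrable M (\<lambda>x. f x powr a * g x powr b)"
  shows "(\<integral>x. f x powr a * g x powr b \<partial>M) \<le> (\<integral>x. f x \<partial>M) powr a * (\<integral>x. g x \<partial>M) powr b"
proof -
  define F G where "F = (\<integral>x. f x \<partial>M)" and "G = (\<integral>x. g x \<partial>M)"
  have FG: "0 < F" "0 < G" using assms by (auto simp: F_def G_def)
  \<comment> \<open>After normalisation to unit integrals, the weighted arithmetic-geometric mean
    inequality holds pointwise and its right-hand side integrates to a + b = 1. This is Hoelder's
    inequality with exponents 1/a and 1/b, endpoints included.\<close>
  have "(\<integral>x. f x powr a * g x powr b / (F powr a * G powr b) \<partial>M)
      \<le> (\<integral>x. a * (f x / F) + b * (g x / G) \<partial>M)"
  proof (rule integral_mono)
    fix x assume x: "x \<in> space M"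
    show "f x powr a * g x powr b / (F powr a * G powr b) \<le> a * (f x / F) + b * (g x / G)"
      using Youngs_inequality_0[of a b "f x / F" "g x / G"] assms FG fpos[OF x] gpos[OF x]
      by (simp add: powr_divide)
  qed (use f g fg in auto)
  also have "\<dots> = a * (F / F) + b * (G / G)"
    using f g by (simp add: F_def G_def)
  also have "\<dots> = 1" using FG assms by simp
  finally show ?thesis using FG by (simp add: F_def G_def field_simps)
qed

lemma integral_pos_of_pos:
  fixes f :: "'b \<Rightarrow> real"
  assumes "integrable M f" "\<And>x. x \<in> space M \<Longrightarrow> 0 < f x" "measure M (space M) \<noteq> 0"
  shows "0 < (\<integral>x. f x \<partial>M)"
proof -
  have "\<not> (AE x in M. f x = 0)"
  proof
    assume "AE x in M. f x = 0"
    then have "AE x in M. False" using AE_space by eventually_elim (use assms(2) in force)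
    then have "emeasure M (space M) = 0" using AE_iff_null[where P = "\<lambda>_. False" and M = M] by (auto simp: null_sets_def)
    then show False using assms(3) by (simp add: measure_def)
  qed
  moreover have "AE x in M. 0 \<le> f x" using assms(2) by (intro AE_I2) (auto intro: less_imp_le)
  ultimately show ?thesis
    using integral_nonneg_eq_0_iff_AE[OF assms(1)] integral_nonneg_AE[of f M] by linarith
qed

text \<open>Here v stands for u at a fixed time and V is any upper bound for the variance of v^p.
  Keeping V abstract leaves the gradient out: the argument is about moments on a probability space.
  The factor 2\<alpha> / (2 - q) is the Beckner constant without its power of the Poincare constant,
  since p q - 1 = \<alpha>.\<close>

lemma beckner_inequality:
  fixes v :: "'b \<Rightarrow> real"
  assumes "measure M (space M) = 1" and "0 < \<alpha>" and "1 < \<beta>"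
    and pos: "\<And>x. x \<in> space M \<Longrightarrow> 0 < v x"
    and int: "\<And>a. integrable M (\<lambda>x. v x powr a)"
    and p: "p = (\<alpha> + \<beta>) / 2" and q: "q = 2 * (\<alpha> + 1) / (\<alpha> + \<beta>)"
    and V: "(\<integral>x. v x powr (\<alpha> + \<beta>) \<partial>M) - (\<integral>x. v x powr p \<partial>M)\<^sup>2 \<le> V"
  shows "(\<integral>x. v x powr (\<alpha> + 1) \<partial>M) - (\<integral>x. v x \<partial>M) powr (\<alpha> + 1)
    \<le> 2 * \<alpha> / (2 - q) * V powr (q / 2)"
proof -
  define I where "I a = (\<integral>x. v x powr a \<partial>M)" for a
  have I_pos: "0 < I a" for a
    unfolding I_def using assms by (intro integral_pos_of_pos int) (auto simp: less_imp_neq[THEN not_sym])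
  have I0: "I 0 = 1"
  proof -
    have "I 0 = (\<integral>x. 1 \<partial>M)" unfolding I_def
      by (intro Bochner_Integration.integral_cong) (use pos in force)+
    then show ?thesis using assms by simp
  qed
  have I1: "I 1 = (\<integral>x. v x \<partial>M)"
    unfolding I_def by (intro Bochner_Integration.integral_cong) (use pos in force)+
  \<comment> \<open>Log-convexity of the moments in the exponent. Every Hoelder step below is an
    instance of it, some with the endpoint \<open>I 0 = 1\<close>.\<close>
  have interpolation: "I (a * s + b * r) \<le> I s powr a * I r powr b"
    if "0 \<le> a" "0 \<le> b" "a + b = 1" for a b s r
  proof -
    have eq: "(v x powr s) powr a * (v x powr r) powr b = v x powr (a * s + b * r)" for x
      by (simp add: powr_powr powr_add mult.commute)
    show ?thesis
      using integral_powr_mult_powr_le[OF int[of s] int[of r], of a b] that pos I_pos[of s] I_pos[of r]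
        int[of "a * s + b * r"]
      unfolding eq I_def by (auto simp: less_imp_neq[THEN not_sym])
  qed
  define A B N where "A = I (\<alpha> + 1)" and "B = I (\<alpha> + \<beta>)" and "N = I p"
  have ABN: "0 < A" "0 < B" "0 < N" by (auto simp: A_def B_def N_def I_pos)
  have q01: "0 < q / 2" "q / 2 < 1" using assms(2,3) by (auto simp: q field_simps)
  have sq: "(\<alpha> + \<beta>) * (q / 2) = \<alpha> + 1" using assms(2,3) by (simp add: q field_simps)
  \<comment> \<open>The exponent p is the midpoint of \<alpha> + 1 and \<beta> - 1, and \<beta> - 1
    in turn lies between \<alpha> + \<beta> and 0 with weights 1 - q/2 and q/2.\<close>
  have "N \<le> A powr (1/2) * I (\<beta> - 1) powr (1/2)"
    unfolding N_def A_def using interpolation[of "1/2" "1/2" "\<alpha> + 1" "\<beta> - 1"] 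
    by (simp add: p add_divide_distrib diff_divide_distrib)
  moreover have "I (\<beta> - 1) \<le> B powr (1 - q / 2)"
  proof -
    have "(1 - q / 2) * (\<alpha> + \<beta>) + (q / 2) * 0 = \<beta> - 1" using sq by (simp add: algebra_simps)
    then show ?thesis
      using interpolation[of "1 - q / 2" "q / 2" "\<alpha> + \<beta>" 0] q01 by (simp add: I0 B_def)
  qed
  ultimately have "N \<le> A powr (1/2) * (B powr (1 - q / 2)) powr (1/2)"
    using mult_left_mono[OF powr_mono2[of "1/2" "I (\<beta> - 1)" "B powr (1 - q / 2)"], of "A powr (1/2)"]
      I_pos[of "\<beta> - 1"] by simp
  then have "N\<^sup>2 \<le> (A powr (1/2) * (B powr (1 - q / 2)) powr (1/2))\<^sup>2"
    using ABN by (intro power_mono) auto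
  also have "\<dots> = A * B powr (1 - q / 2)"
    using ABN by (simp add: power_mult_distrib powr_half_sqrt)
  finally have N2: "N\<^sup>2 \<le> A * B powr (1 - q / 2)" .
  have Bsplit: "B = B powr (1 - q / 2) * B powr (q / 2)"
    using ABN by (simp add: powr_add[symmetric])
  \<comment> \<open>The squared ratio of the L^1 norm to the L^2 norm of v^p. It makes the gap at
    most B^(q/2) (1 - c), and 1 - c <= (1 - c)^(q/2) because 0 <= 1 - c <= 1 and q/2 < 1.\<close>
  define c where "c = N\<^sup>2 / B"
  have c0: "0 < c" using ABN by (simp add: c_def)
  have c1: "c \<le> 1"
  proof -
    have "N \<le> B powr (1/2)"
      using interpolation[of "1/2" "1/2" "\<alpha> + \<beta>" 0] by (simp add: I0 B_def N_def p)
    then have "N\<^sup>2 \<le> (B powr (1/2))\<^sup>2" using ABN by (intro power_mono) auto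
    then show ?thesis using ABN by (simp add: c_def powr_half_sqrt)
  qed
  have "c * B powr (q / 2) \<le> A"
  proof -
    have "c * B powr (q / 2) * B powr (1 - q / 2) = N\<^sup>2"
      using Bsplit ABN unfolding c_def by (simp add: mult.assoc mult.commute[of "B powr (q/2)"])
    then have "c * B powr (q / 2) * B powr (1 - q / 2) \<le> A * B powr (1 - q / 2)"
      using N2 by simp
    then show ?thesis using ABN by simp
  qed
  then have "B powr (q / 2) - A \<le> B powr (q / 2) * (1 - c)" by (simp add: algebra_simps)
  also have "\<dots> \<le> B powr (q / 2) * (1 - c) powr (q / 2)"
  proof (rule mult_left_mono)
    show "1 - c \<le> (1 - c) powr (q / 2)"
      using powr_mono'[of "q / 2" 1 "1 - c"] c0 c1 q01 by (cases "c = 1") auto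
  qed simp
  also have "\<dots> = (B * (1 - c)) powr (q / 2)"
    using ABN c1 by (simp add: powr_mult)
  also have "B * (1 - c) = B - N\<^sup>2" using ABN by (simp add: c_def algebra_simps)
  also have "(B - N\<^sup>2) powr (q / 2) \<le> V powr (q / 2)"
  proof (rule powr_mono2)
    show "0 \<le> B - N\<^sup>2" using c1 ABN by (simp add: c_def)
    show "B - N\<^sup>2 \<le> V" using V by (simp add: B_def N_def I_def)
  qed (use q01 in simp)
  finally have gap: "B powr (q / 2) - A \<le> V powr (q / 2)" .
  define R where "R = I 1"
  have R: "0 < R" by (simp add: R_def I_pos)
  define \<kappa> where "\<kappa> = 2 * \<alpha> / (2 - q)"
  have \<kappa>: "\<kappa> = \<alpha> * (\<alpha> + \<beta>) / (\<beta> - 1)"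
  proof -
    have *: "2 - q = 2 * (\<beta> - 1) / (\<alpha> + \<beta>)" using assms(2,3) by (simp add: q field_simps)
    show ?thesis unfolding \<kappa>_def * using assms(3) by (simp add: divide_simps)
  qed
  have \<kappa>0: "0 < \<kappa>" using assms(2,3) by (simp add: \<kappa>)
  \<comment> \<open>The weight that places \<alpha> + 1 between 1 and \<alpha> + \<beta>, so that A
    is interpolated between the first moment R and B. The two multiplications of the logarithmic
    inequality below normalise the coefficient of ln R to \<alpha> + 1; the coefficient of ln A then
    comes out as 1 + \<kappa>.\<close>
  define \<theta> where "\<theta> = (\<beta> - 1) / (\<alpha> + \<beta> - 1)"
  have \<theta>: "0 < \<theta>" "\<theta> < 1" "1 - \<theta> = \<alpha> / (\<alpha> + \<beta> - 1)" using assms(2,3) by (auto simp: \<theta>_def field_simps)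
  have "A \<le> R powr \<theta> * B powr (1 - \<theta>)"
  proof -
    have "\<theta> * 1 + (1 - \<theta>) * (\<alpha> + \<beta>) = \<alpha> + 1"
    proof -
      have "\<theta> * 1 + (1 - \<theta>) * (\<alpha> + \<beta>) = ((\<beta> - 1) + \<alpha> * (\<alpha> + \<beta>)) / (\<alpha> + \<beta> - 1)"
        unfolding \<theta>(3) unfolding \<theta>_def by (simp add: add_divide_distrib)
      also have "(\<beta> - 1) + \<alpha> * (\<alpha> + \<beta>) = (\<alpha> + 1) * (\<alpha> + \<beta> - 1)" by (simp add: algebra_simps)
      finally show ?thesis using assms(2,3) by simp
    qed
    then show ?thesis
      using interpolation[of \<theta> "1 - \<theta>" 1 "\<alpha> + \<beta>"] \<theta> by (simp add: A_def R_def B_def)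
  qed
  then have "ln A \<le> ln (R powr \<theta> * B powr (1 - \<theta>))"
    using ABN R by (subst ln_le_cancel_iff) auto
  then have "ln A \<le> \<theta> * ln R + (1 - \<theta>) * ln B"
    using ABN R by (simp add: ln_mult ln_powr)
  then have "(\<alpha> + \<beta> - 1) * ln A \<le> (\<alpha> + \<beta> - 1) * (\<theta> * ln R + (1 - \<theta>) * ln B)"
    using assms(2,3) by (intro mult_left_mono) auto
  also have "\<dots> = ((\<alpha> + \<beta> - 1) * \<theta>) * ln R + ((\<alpha> + \<beta> - 1) * (1 - \<theta>)) * ln B"
    by (simp only: distrib_left mult.assoc)
  also have "(\<alpha> + \<beta> - 1) * \<theta> = \<beta> - 1" using assms(2,3) by (simp add: \<theta>_def)
  also have "(\<alpha> + \<beta> - 1) * (1 - \<theta>) = \<alpha>" unfolding \<theta>(3) using assms(2,3) by simp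
  finally have "(\<alpha> + \<beta> - 1) * ln A \<le> (\<beta> - 1) * ln R + \<alpha> * ln B" .
  then have "(\<alpha> + 1) / (\<beta> - 1) * ((\<alpha> + \<beta> - 1) * ln A) \<le> (\<alpha> + 1) / (\<beta> - 1) * ((\<beta> - 1) * ln R + \<alpha> * ln B)"
    using assms(2,3) by (intro mult_left_mono) auto
  also have "\<dots> = (\<alpha> + 1) * ln R + (\<alpha> + 1) / (\<beta> - 1) * (\<alpha> * ln B)"
    using assms(3) by (simp add: distrib_left)
  finally have "(\<alpha> + 1) / (\<beta> - 1) * ((\<alpha> + \<beta> - 1) * ln A)
      \<le> (\<alpha> + 1) * ln R + (\<alpha> + 1) / (\<beta> - 1) * (\<alpha> * ln B)" .
  moreover have "(\<alpha> + 1) / (\<beta> - 1) * ((\<alpha> + \<beta> - 1) * ln A) = (1 + \<kappa>) * ln A"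
  proof -
    have "1 + \<kappa> = ((\<beta> - 1) + \<alpha> * (\<alpha> + \<beta>)) / (\<beta> - 1)"
      unfolding \<kappa> add_divide_distrib using assms(3) by simp
    also have "(\<beta> - 1) + \<alpha> * (\<alpha> + \<beta>) = (\<alpha> + 1) * (\<alpha> + \<beta> - 1)" by (simp add: algebra_simps)
    finally show ?thesis by simp
  qed
  moreover have "(\<alpha> + 1) / (\<beta> - 1) * (\<alpha> * ln B) = \<kappa> * (q / 2 * ln B)"
    unfolding \<kappa> q using assms(2,3) by (simp add: divide_simps) (simp add: algebra_simps)
  ultimately have "(1 + \<kappa>) * ln A \<le> (\<alpha> + 1) * ln R + \<kappa> * (q / 2 * ln B)"
    by (simp only:)
  then have lnR: "ln A + \<kappa> * (ln A - q / 2 * ln B) \<le> (\<alpha> + 1) * ln R"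
    by (simp add: algebra_simps)
  \<comment> \<open>In terms of z the interpolation reads A z^\<kappa> <= R^(\<alpha> + 1). Two
    tangent bounds, 1 + \<kappa> ln z <= z^\<kappa> and 1 - 1/z <= ln z, make it linear in the gap
    B^(q/2) - A with the exact factor \<kappa>.\<close>
  define z where "z = A / B powr (q / 2)"
  have z: "0 < z" "ln z = ln A - q / 2 * ln B" using ABN by (auto simp: z_def ln_div ln_powr)
  have "ln (1 / z) \<le> 1 / z - 1" using z by (intro ln_le_minus_one) auto
  then have "A * (1 - 1 / z) \<le> A * ln z" using ABN z by (intro mult_left_mono) (auto simp: ln_div)
  moreover have "A * (1 - 1 / z) = A - B powr (q / 2)" using ABN by (simp add: z_def algebra_simps)
  ultimately have lnz: "A - B powr (q / 2) \<le> A * ln z" by simp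
  have "A + \<kappa> * (A - B powr (q / 2)) \<le> A * (1 + \<kappa> * ln z)"
    using mult_left_mono[OF lnz, of \<kappa>] \<kappa>0 by (simp add: algebra_simps)
  also have "\<dots> \<le> A * exp (\<kappa> * ln z)"
    using ABN by (intro mult_left_mono exp_ge_add_one_self) auto
  also have "\<dots> = exp (ln A + \<kappa> * ln z)" using ABN by (simp add: exp_add)
  also have "\<dots> \<le> exp ((\<alpha> + 1) * ln R)" using lnR by (simp add: z)
  also have "\<dots> = R powr (\<alpha> + 1)" using R by (simp add: powr_def)
  finally have "A - R powr (\<alpha> + 1) \<le> \<kappa> * (B powr (q / 2) - A)" by (simp add: algebra_simps)
  also have "\<dots> \<le> \<kappa> * V powr (q / 2)" using gap \<kappa>0 by simp
  finally show ?thesis by (simp add: A_def R_def I1[symmetric] \<kappa>_def I_def)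
qed

section \<open>The divergence theorem for tangential fields\<close>

text \<open>A direction v with n . v > 0 leaves \<Omega> at y, hence leaves the ball around x, so it
  makes no acute angle with x - y. A vector with this property for a whole open half-space is a
  nonpositive multiple of its normal n.\<close>

lemma nearest_point_eq_normal:
  assumes \<nu>: "exterior_unit_normal_at \<Omega> y n" and ball: "ball x (dist x y) \<subseteq> \<Omega>"
  shows "x - y = - dist x y *\<^sub>R n"
proof -
  define z where "z = x - y"
  have n: "norm n = 1" using \<nu> by (simp add: exterior_unit_normal_at_def)
  have obtuse: "v \<bullet> z \<le> 0" if v: "n \<bullet> v > 0" for v
  proof -
    \<comment> \<open>Half the cosine of the angle between the unit vector n and v, so that v lies
      strictly inside the exterior cone belonging to e.\<close>
    define e where "e = n \<bullet> v / (2 * norm v)"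
    have v0: "norm v > 0" using v by auto
    then have e: "e > 0" "n \<bullet> v > e * norm v" using v by (auto simp: e_def)
    obtain r where r: "r > 0" and out: "\<And>w. w \<in> ball y r \<Longrightarrow> n \<bullet> (w - y) > e * norm (w - y) \<Longrightarrow> w \<notin> \<Omega>"
      using \<nu> e unfolding exterior_unit_normal_at_def by blast
    have small: "2 * (v \<bullet> z) \<le> s * (norm v)\<^sup>2" if s: "0 < s" "s < r / norm v" for s
    proof -
      have "y + s *\<^sub>R v \<in> ball y r" using s v0 by (simp add: dist_norm field_simps)
      moreover have "n \<bullet> (y + s *\<^sub>R v - y) > e * norm (y + s *\<^sub>R v - y)"
        using e s by (simp add: mult.left_commute)
      ultimately have "y + s *\<^sub>R v \<notin> ball x (dist x y)" using out ball by blast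
      then have "norm z \<le> norm (z - s *\<^sub>R v)"
        by (simp add: z_def dist_norm algebra_simps)
      then have "(norm z)\<^sup>2 \<le> (norm (z - s *\<^sub>R v))\<^sup>2" by (intro power_mono) auto
      also have "\<dots> = (norm z)\<^sup>2 - s * (2 * (v \<bullet> z)) + s * (s * (norm v)\<^sup>2)"
        by (simp add: power2_norm_eq_inner inner_diff inner_commute algebra_simps)
      finally have "s * (2 * (v \<bullet> z)) \<le> s * (s * (norm v)\<^sup>2)" by simp
      then show ?thesis using s by simp
    qed
    have "((\<lambda>s. s * (norm v)\<^sup>2) \<longlongrightarrow> 0 * (norm v)\<^sup>2) (at_right 0)"
      by (intro tendsto_intros)
    then have "2 * (v \<bullet> z) \<le> 0 * (norm v)\<^sup>2"
    proof (rule tendsto_lowerbound)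
      have "0 < r / norm v" using r v0 by simp
      then show "\<forall>\<^sub>F s in at_right 0. 2 * (v \<bullet> z) \<le> s * (norm v)\<^sup>2"
        using small unfolding eventually_at_right_field by blast
    qed simp
    then show ?thesis by simp
  qed
  have n2: "n \<bullet> n = 1" using n by (simp add: norm_eq_1)
  \<comment> \<open>The test direction is the tangential part of z, pushed outwards by \<delta> n to
    make its normal component positive. In the limit \<delta> -> 0 the tangential part
    vanishes.\<close>
  have le: "(norm z)\<^sup>2 - (n \<bullet> z)\<^sup>2 \<le> 0"
  proof -
    have "((\<lambda>\<delta>. (norm z)\<^sup>2 - (n \<bullet> z)\<^sup>2 + \<delta> * (n \<bullet> z)) \<longlongrightarrow> (norm z)\<^sup>2 - (n \<bullet> z)\<^sup>2 + 0 * (n \<bullet> z)) (at_right 0)"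
      by (intro tendsto_intros)
    then have "(norm z)\<^sup>2 - (n \<bullet> z)\<^sup>2 + 0 * (n \<bullet> z) \<le> 0"
    proof (rule tendsto_upperbound)
      have "(norm z)\<^sup>2 - (n \<bullet> z)\<^sup>2 + \<delta> * (n \<bullet> z) \<le> 0" if "\<delta> > 0" for \<delta>
        using obtuse[of "z - (n \<bullet> z) *\<^sub>R n + \<delta> *\<^sub>R n"] that n2
        unfolding power2_norm_eq_inner power2_eq_square[of "n \<bullet> z"]
        by (simp add: inner_diff inner_add inner_commute)
      then show "\<forall>\<^sub>F \<delta> in at_right 0. (norm z)\<^sup>2 - (n \<bullet> z)\<^sup>2 + \<delta> * (n \<bullet> z) \<le> 0"
        by (auto simp: eventually_at_filter)
    qed simp
    then show ?thesis by simp
  qed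
  have "norm z \<le> - (n \<bullet> z)"
  proof (rule power2_le_imp_le)
    show "0 \<le> - (n \<bullet> z)" using obtuse[of n] n2 by simp
  qed (use le in simp)
  then have "norm z * norm z \<le> norm z * - (n \<bullet> z)" by (intro mult_left_mono) auto
  moreover have "(norm (z + norm z *\<^sub>R n))\<^sup>2 = 2 * (norm z * norm z) + 2 * (norm z * (n \<bullet> z))"
    unfolding power2_norm_eq_inner using n2
    by (simp add: inner_add inner_commute norm_eq_sqrt_inner)
  ultimately have "(norm (z + norm z *\<^sub>R n))\<^sup>2 \<le> 0" by simp
  then have "z = - norm z *\<^sub>R n" by (simp add: add_eq_0_iff2)
  then show ?thesis by (simp add: z_def dist_norm)
qed

text \<open>The interior cone contains short segments from x in every direction v with n . v < 0,
  and one-sided directional derivatives along them determine both linear maps there. These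
  directions span the space. Boundary gradients are thereby well defined although no full
  neighbourhood of x lies in S in general.\<close>

lemma has_derivative_within_unique_of_normal:
  fixes f :: "'a::euclidean_space \<Rightarrow> 'b::real_normed_vector"
  assumes \<nu>: "exterior_unit_normal_at \<Omega> x n" and sub: "\<Omega> \<subseteq> S" and xS: "x \<in> S"
    and A: "(f has_derivative A) (at x within S)" and B: "(f has_derivative B) (at x within S)"
  shows "A = B"
proof
  have n: "n \<bullet> n = 1" using \<nu> by (simp add: exterior_unit_normal_at_def norm_eq_1)
  have linA: "linear A" and linB: "linear B" using A B by (auto intro: has_derivative_linear)
  have inward: "A v = B v" if v: "n \<bullet> v < 0" for v
  proof -
    define e where "e = - (n \<bullet> v) / (2 * norm v)"
    have v0: "norm v > 0" using v by auto
    then have e: "e > 0" "n \<bullet> v < - e * norm v" using v by (auto simp: e_def divide_neg_pos)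
    obtain r where r: "r > 0" and inn: "\<And>w. w \<in> ball x r \<Longrightarrow> n \<bullet> (w - x) < - e * norm (w - x) \<Longrightarrow> w \<in> \<Omega>"
      using \<nu> e unfolding exterior_unit_normal_at_def by blast
    define \<delta> where "\<delta> = r / (2 * norm v)"
    have \<delta>: "0 < \<delta>" using r v0 by (simp add: \<delta>_def)
    have seg: "(\<lambda>s. x + s *\<^sub>R v) ` {0..\<delta>} \<subseteq> S"
    proof safe
      fix s assume s: "s \<in> {0..\<delta>}"
      show "x + s *\<^sub>R v \<in> S"
      proof (cases "s = 0")
        case False
        then have "s > 0" using s by auto
        have "x + s *\<^sub>R v \<in> \<Omega>"
        proof (rule inn)
          have "s * norm v \<le> \<delta> * norm v" using s v0 by auto
          also have "\<dots> < r" using r v0 by (simp add: \<delta>_def)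
          finally show "x + s *\<^sub>R v \<in> ball x r" using \<open>s > 0\<close> by (simp add: dist_norm)
          show "n \<bullet> (x + s *\<^sub>R v - x) < - e * norm (x + s *\<^sub>R v - x)"
            using mult_strict_left_mono[OF e(2) \<open>s > 0\<close>] \<open>s > 0\<close> by (simp add: algebra_simps)
        qed
        then show ?thesis using sub by auto
      qed (use xS in simp)
    qed
    have der: "((\<lambda>s. f (x + s *\<^sub>R v)) has_vector_derivative D v) (at 0 within {0..\<delta>})"
      if D: "(f has_derivative D) (at x within S)" for D
    proof -
      have "((\<lambda>s. x + s *\<^sub>R v) has_derivative (\<lambda>s. s *\<^sub>R v)) (at 0 within {0..\<delta>})"
        by (auto intro!: derivative_eq_intros)
      moreover have "(f has_derivative D) (at (x + 0 *\<^sub>R v) within (\<lambda>s. x + s *\<^sub>R v) ` {0..\<delta>})"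
        using has_derivative_subset[OF D seg] by simp
      ultimately have "(f \<circ> (\<lambda>s. x + s *\<^sub>R v) has_derivative D \<circ> (\<lambda>s. s *\<^sub>R v)) (at 0 within {0..\<delta>})"
        by (rule diff_chain_within)
      moreover have "D \<circ> (\<lambda>s. s *\<^sub>R v) = (\<lambda>s. s *\<^sub>R D v)"
        using has_derivative_linear[OF D] by (auto simp: linear_cmul)
      ultimately show ?thesis by (simp add: has_vector_derivative_def o_def)
    qed
    show ?thesis
      using vector_derivative_unique_within[OF _ der[OF A] der[OF B]] \<delta>
      by (simp add: trivial_limit_within islimpt_Icc)
  qed
  fix v
  \<comment> \<open>Chosen so that n . (v - k n) = n . v - k is negative; v is then a combination of
    the two inward vectors v - k n and -n.\<close>
  define k where "k = \<bar>n \<bullet> v\<bar> + 1"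
  have "A (v - k *\<^sub>R n) = B (v - k *\<^sub>R n)"
    by (rule inward) (use n in \<open>simp add: inner_diff k_def\<close>)
  moreover have "A (- n) = B (- n)" by (rule inward) (use n in simp)
  ultimately show "A v = B v"
    using linA linB by (simp add: linear_diff linear_cmul linear_neg)
qed

section \<open>Bounds on compact sets and integrals over the whole space\<close>

lemma continuous_on_compact_obtain_bound:
  fixes f :: "'b::topological_space \<Rightarrow> 'c::real_normed_vector"
  assumes "compact K" "continuous_on K f"
  obtains B where "\<And>x. x \<in> K \<Longrightarrow> norm (f x) \<le> B"
proof -
  have "bounded (f ` K)" by (rule compact_imp_bounded[OF compact_continuous_image[OF assms(2,1)]])
  then obtain B where "\<forall>y\<in>f ` K. norm y \<le> B" unfolding bounded_iff by blast
  then show ?thesis using that by blast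
qed

lemma integrable_lborel_translate:
  fixes f :: "'a::euclidean_space \<Rightarrow> real"
  assumes "integrable lborel f"
  shows "integrable lborel (\<lambda>x. f (x + c))"
proof -
  have "integrable (distr lborel borel ((+) c)) f" using assms by (simp add: lborel_distr_plus)
  then show ?thesis by (subst (asm) integrable_distr_eq) (use assms in \<open>auto simp: add.commute\<close>)
qed

lemma integral_lborel_translate:
  fixes f :: "'a::euclidean_space \<Rightarrow> real"
  assumes "f \<in> borel_measurable borel"
  shows "(\<integral>x. f (x + c) \<partial>lborel) = (\<integral>x. f x \<partial>lborel)"
proof -
  have "(\<integral>x. f x \<partial>lborel) = (\<integral>x. f x \<partial>distr lborel borel ((+) c))" by (simp add: lborel_distr_plus)
  also have "\<dots> = (\<integral>x. f (c + x) \<partial>lborel)" by (rule integral_distr) (use assms in auto)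
  finally show ?thesis by (simp add: add.commute)
qed

lemma integrable_lborel_bounded_support:
  fixes f :: "'a::euclidean_space \<Rightarrow> real"
  assumes "f \<in> borel_measurable borel" "\<And>x. \<bar>f x\<bar> \<le> K" "\<And>x. x \<notin> ball 0 R \<Longrightarrow> f x = 0"
  shows "integrable lborel f"
proof (rule Bochner_Integration.integrable_bound)
  show "integrable lborel (\<lambda>x. K * indicator (ball 0 R) x :: real)"
    by (intro integrable_mult_right integrable_real_indicator emeasure_bounded_finite) auto
  show "AE x in lborel. norm (f x) \<le> norm (K * indicator (ball 0 R) x)"
    using assms(2,3) by (intro AE_I2) (metis abs_ge_self abs_ge_zero indicator_simps mult_1_right mult_zero_right
      norm_eq_zero order.trans real_norm_def)
qed (use assms(1) in simp)

text \<open>Differentiability classes here provide continuity of the derivative for each fixed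
  direction only. A bound uniform in the direction is assembled from the finitely many basis
  vectors.\<close>

lemma linear_family_bound:
  fixes A :: "'b::topological_space \<Rightarrow> 'a::euclidean_space \<Rightarrow> 'c::real_normed_vector"
  assumes "compact K" and lin: "\<And>x. x \<in> K \<Longrightarrow> linear (A x)"
    and cont: "\<And>b. b \<in> Basis \<Longrightarrow> continuous_on K (\<lambda>x. A x b)"
  obtains L where "0 \<le> L" "\<And>x w. x \<in> K \<Longrightarrow> norm (A x w) \<le> L * norm w"
proof -
  have "\<exists>B. \<forall>x\<in>K. norm (A x b) \<le> B" if "b \<in> Basis" for b
    by (rule continuous_on_compact_obtain_bound[OF assms(1) cont[OF that]]) blast
  then obtain B where B: "\<And>b x. b \<in> Basis \<Longrightarrow> x \<in> K \<Longrightarrow> norm (A x b) \<le> B b" by metis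
  show ?thesis
  proof
    show "0 \<le> (\<Sum>b\<in>Basis. \<bar>B b\<bar>)" by (simp add: sum_nonneg)
    fix x w assume x: "x \<in> K"
    interpret linear "A x" by (rule lin[OF x])
    have "norm (A x w) = norm (\<Sum>b\<in>Basis. (w \<bullet> b) *\<^sub>R A x b)"
      by (subst euclidean_representation[symmetric, of w]) (simp add: sum scale del: euclidean_representation)
    also have "\<dots> \<le> (\<Sum>b\<in>Basis. \<bar>B b\<bar> * norm w)"
    proof (rule sum_norm_le)
      fix b :: 'a assume b: "b \<in> Basis"
      have "\<bar>w \<bullet> b\<bar> * norm (A x b) \<le> norm w * \<bar>B b\<bar>"
        using Basis_le_norm[OF b] B[OF b x] by (intro mult_mono) auto
      then show "norm ((w \<bullet> b) *\<^sub>R A x b) \<le> \<bar>B b\<bar> * norm w" by (simp add: mult.commute)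
    qed
    finally show "norm (A x w) \<le> (\<Sum>b\<in>Basis. \<bar>B b\<bar>) * norm w" by (simp add: sum_distrib_right)
  qed
qed

text \<open>Moves the integral to \<open>lborel\<close> on the whole space, where translation
  invariance serves as discrete integration by parts.\<close>

lemma integral_lebesgue_on_open:
  fixes f :: "'a::euclidean_space \<Rightarrow> real"
  assumes "open \<Omega>" "continuous_on \<Omega> f"
  shows "(\<integral>x. f x \<partial>lebesgue_on \<Omega>) = (\<integral>x. indicator \<Omega> x * f x \<partial>lborel)"
proof -
  have "(\<integral>x. f x \<partial>lebesgue_on \<Omega>) = (\<integral>x. indicator \<Omega> x *\<^sub>R f x \<partial>lebesgue)"
    using assms by (subst integral_restrict_space) auto
  also have "\<dots> = (\<integral>x. indicator \<Omega> x *\<^sub>R f x \<partial>lborel)"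
    using borel_measurable_continuous_on_indicator[of \<Omega> f] assms by (subst integral_completion) auto
  finally show ?thesis by simp
qed

text \<open>The function s / (s + e) is concave on s >= 0 with slope e / (s + e)^2, so it stays
  below its tangents. This carries the one-sided bound for the squared distance over to the
  cutoff.\<close>

lemma concave_quotient_tangent:
  fixes s s' e :: real
  assumes "0 \<le> s" "0 \<le> s'" "0 < e"
  shows "s' / (s' + e) - s / (s + e) \<le> e / (s + e)\<^sup>2 * (s' - s)"
proof -
  have "e / (s + e)\<^sup>2 * (s' - s) - (s' / (s' + e) - s / (s + e)) = e * (s' - s)\<^sup>2 / ((s + e)\<^sup>2 * (s' + e))"
  proof -
    have "s + e \<noteq> 0" "s' + e \<noteq> 0" using assms by auto
    then show ?thesis by (simp add: divide_simps) (simp add: power2_eq_square algebra_simps)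
  qed
  also have "\<dots> \<ge> 0" using assms by simp
  finally show ?thesis by simp
qed

text \<open>Backward difference quotients of F, tested with the cutoff \<open>\<zeta>\<close>, tend
  to minus the divergence. By translation the differences fall on the cutoff, whose increment in
  direction w is at most \<open>\<eta>\<close> times 2 (z . w) + |w|^2. The first-order part pairs
  with F to 2 \<eta> (F . z) <= 2 L \<eta> D, which is bounded and tends to 0 pointwise; this gives
  the sign.\<close>

lemma integral_divergence_nonneg:
  fixes F :: "'a::euclidean_space \<Rightarrow> 'a"
  assumes "open \<Omega>" "bounded \<Omega>" and \<nu>: "\<And>x. x \<in> frontier \<Omega> \<Longrightarrow> exterior_unit_normal_at \<Omega> x (\<nu> x)"
    and dF: "\<And>x. x \<in> closure \<Omega> \<Longrightarrow> (F has_derivative F' x) (at x within closure \<Omega>)"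
    and cF: "\<And>b. b \<in> Basis \<Longrightarrow> continuous_on (closure \<Omega>) (\<lambda>x. F' x b)"
    and tang: "\<And>x. x \<in> frontier \<Omega> \<Longrightarrow> F x \<bullet> \<nu> x = 0"
  shows "0 \<le> (\<integral>x. (\<Sum>b\<in>Basis. F' x b \<bullet> b) \<partial>lebesgue_on \<Omega>)"
proof -
  have clO: "compact (closure \<Omega>)" using assms by (simp add: compact_closure)
  have Osub: "\<Omega> \<subseteq> closure \<Omega>" by (rule closure_subset)
  obtain L where L: "0 \<le> L" "\<And>x w. x \<in> closure \<Omega> \<Longrightarrow> norm (F' x w) \<le> L * norm w"
    using linear_family_bound[OF clO has_derivative_linear[OF dF] cF] by metis
  have contF: "continuous_on (closure \<Omega>) F"
    by (rule has_derivative_continuous_on[OF dF])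
  obtain M where M: "0 \<le> M" "\<And>x. x \<in> closure \<Omega> \<Longrightarrow> norm (F x) \<le> M"
  proof -
    obtain B where "\<And>x. x \<in> closure \<Omega> \<Longrightarrow> norm (F x) \<le> B"
      using continuous_on_compact_obtain_bound[OF clO contF] by blast
    then show ?thesis using that[of "\<bar>B\<bar>"] by (meson abs_ge_self abs_ge_zero order_trans)
  qed
  obtain R where R: "\<Omega> \<subseteq> ball 0 R" using bounded_subset_ballD[OF assms(2)] by blast
  define C where "C = - \<Omega>"
  have C: "closed C" "C \<noteq> {}"
  proof -
    show "closed C" using assms(1) by (simp add: C_def closed_def)
    show "C \<noteq> {}" using assms(2) not_bounded_UNIV[where 'a = 'a] unfolding C_def by (metis Compl_empty_eq double_complement)
  qed
  define d where "d x = infdist x C" for x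
  obtain Y where Y: "\<And>x. Y x \<in> C" "\<And>x. d x = dist x (Y x)"
  proof -
    have "\<forall>x. \<exists>y. y \<in> C \<and> d x = dist x y"
      unfolding d_def using infdist_attains_inf[OF C] by blast
    then show ?thesis using that by metis
  qed
  define z where "z x = x - Y x" for x
  define D where "D x = (d x)\<^sup>2" for x
  have d_nonneg: "0 \<le> d x" for x by (simp add: d_def infdist_nonneg)
  have D_nonneg: "0 \<le> D x" for x by (simp add: D_def)
  have d_pos: "0 < d x" if "x \<in> \<Omega>" for x
    using infdist_pos_not_in_closed[OF C] that by (simp add: d_def C_def)
  have D_pos: "0 < D x" if "x \<in> \<Omega>" for x using d_pos[OF that] by (simp add: D_def)
  have D0: "D x = 0" if "x \<notin> \<Omega>" for x
    using that by (simp add: D_def d_def C_def)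
  have D_shift: "D (x + w) \<le> D x + (2 * (z x \<bullet> w) + w \<bullet> w)" for x w
  proof -
    have "d (x + w) \<le> dist (x + w) (Y x)" unfolding d_def by (rule infdist_le[OF Y(1)])
    then have "D (x + w) \<le> (norm (z x + w))\<^sup>2"
      unfolding D_def z_def using d_nonneg by (intro power_mono) (auto simp: dist_norm algebra_simps)
    also have "\<dots> = (norm (z x))\<^sup>2 + (2 * (z x \<bullet> w) + w \<bullet> w)"
      by (simp add: power2_norm_eq_inner inner_add inner_commute)
    also have "norm (z x) = d x" by (simp add: Y(2) z_def dist_norm)
    finally show ?thesis by (simp add: D_def)
  qed
  have ballO: "ball x (d x) \<subseteq> \<Omega>" for x
  proof
    fix w assume "w \<in> ball x (d x)"
    then have "\<not> infdist x C \<le> dist x w" by (simp add: d_def)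
    then show "w \<in> \<Omega>" using infdist_le[of w C x] by (auto simp: C_def)
  qed
  have cballO: "cball x (d x) \<subseteq> closure \<Omega>" if "x \<in> \<Omega>" for x
    using closure_mono[OF ballO[of x]] d_pos[OF that] by simp
  have Yfront: "Y x \<in> frontier \<Omega>" if "x \<in> \<Omega>" for x
    using cballO[OF that] Y[of x] assms(1) by (auto simp: frontier_def interior_open C_def)
  \<comment> \<open>\<Omega> need not be convex, so the derivative bound gives a Lipschitz estimate
    on convex subsets only. The closed ball of radius \<open>d x\<close> is such a subset of the
    closure, and it reaches the nearest boundary point.\<close>
  have lip: "norm (F w - F x) \<le> L * norm (w - x)" if x: "x \<in> \<Omega>" and w: "w \<in> cball x (d x)" for x w
  proof (rule differentiable_bound)
    fix y assume y: "y \<in> cball x (d x)"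
    then show "(F has_derivative F' y) (at y within cball x (d x))"
      using has_derivative_subset[OF dF cballO[OF x]] cballO[OF x] by blast
    show "onorm (F' y) \<le> L" using L cballO[OF x] y by (intro onorm_le) blast
  qed (use w d_nonneg in auto)
  have tangential: "F x \<bullet> z x \<le> L * D x" if x: "x \<in> \<Omega>" for x
  proof -
    have zx: "z x = - d x *\<^sub>R \<nu> (Y x)"
      using nearest_point_eq_normal[OF \<nu>[OF Yfront[OF x]], of x] ballO[of x] Y(2)[of x] by (simp add: z_def)
    have "F x \<bullet> z x = d x * ((F (Y x) - F x) \<bullet> \<nu> (Y x))"
      using tang[OF Yfront[OF x]] by (simp add: zx inner_diff)
    also have "\<dots> \<le> d x * (norm (F (Y x) - F x) * norm (\<nu> (Y x)))"
      using d_nonneg by (intro mult_left_mono norm_cauchy_schwarz) auto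
    also have "norm (\<nu> (Y x)) = 1" using \<nu>[OF Yfront[OF x]] by (simp add: exterior_unit_normal_at_def)
    also have "d x * (norm (F (Y x) - F x) * 1) \<le> d x * (L * d x)"
      using lip[OF x, of "Y x"] Y(2)[of x] d_nonneg
      by (intro mult_left_mono) (auto simp: dist_norm norm_minus_commute)
    finally show ?thesis by (simp add: D_def power2_eq_square algebra_simps)
  qed
  \<comment> \<open>The extension by zero makes translations of the whole space applicable. It may
    jump at the frontier; quotients reaching across the jump are controlled by the smallness of the
    cutoff there.\<close>
  define G where "G x = indicator \<Omega> x *\<^sub>R F x" for x
  have [measurable]: "\<Omega> \<in> sets borel" using assms(1) by simp
  have G_meas [measurable]: "G \<in> borel_measurable borel"
    unfolding G_def using assms(1) continuous_on_subset[OF contF Osub]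
    by (intro borel_measurable_continuous_on_indicator) auto
  have Gb: "\<bar>G x \<bullet> b\<bar> \<le> M" if "b \<in> Basis" for x b
  proof -
    have "norm (G x) \<le> M" using M Osub by (auto simp: G_def indicator_def)
    then show ?thesis using Basis_le_norm[OF that, of "G x"] by linarith
  qed
  have G0: "G x = 0" if "x \<notin> \<Omega>" for x using that by (simp add: G_def)
  have D_meas [measurable]: "D \<in> borel_measurable borel"
    unfolding D_def d_def
    by (intro borel_measurable_continuous_onI continuous_intros continuous_on_infdist)
  \<comment> \<open>a smooth cutoff in the squared distance: it vanishes to second order on the complement,
    so it can be shifted over the whole space without any information on the volume of the boundary\<close>
  define \<zeta> where "\<zeta> e x = D x / (D x + e)" for e x
  have \<zeta>_meas [measurable]: "\<zeta> e \<in> borel_measurable borel" for e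
    unfolding \<zeta>_def by measurable
  have \<zeta>0: "\<zeta> e x = 0" if "x \<notin> \<Omega>" for e x using D0[OF that] by (simp add: \<zeta>_def)
  have \<zeta>_bounds: "0 \<le> \<zeta> e x" "\<zeta> e x \<le> 1" "\<zeta> e x \<le> D x / e" if "0 < e" for e x
    using that D_nonneg[of x] by (auto simp: \<zeta>_def field_simps)
  \<comment> \<open>The slope of s / (s + e) at s = D x. The bound 1 / e serves the second-order
    remainder, the bound on \<open>\<eta> e x * D x\<close> the domination of the main term.\<close>
  define \<eta> where "\<eta> e x = e / (D x + e)\<^sup>2" for e x
  have \<eta>_nonneg: "0 \<le> \<eta> e x" if "0 < e" for e x using that by (simp add: \<eta>_def)
  have \<eta>_le: "\<eta> e x \<le> 1 / e" if "0 < e" for e x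
  proof -
    have "e * e \<le> (D x + e)\<^sup>2"
      using that D_nonneg[of x] unfolding power2_eq_square by (intro mult_mono) auto
    then show ?thesis using that D_nonneg[of x] by (simp add: \<eta>_def divide_simps)
  qed
  have \<eta>D_le: "\<eta> e x * D x \<le> 1" if "0 < e" for e x
  proof -
    have "e * D x \<le> (D x + e)\<^sup>2"
      using that D_nonneg[of x] unfolding power2_eq_square by (intro mult_mono) auto
    then show ?thesis using that D_nonneg[of x] by (simp add: \<eta>_def divide_simps)
  qed
  have \<zeta>_shift: "\<zeta> e (x + w) - \<zeta> e x \<le> \<eta> e x * (2 * (z x \<bullet> w) + w \<bullet> w)" if "0 < e" for e x w
  proof -
    have "\<zeta> e (x + w) - \<zeta> e x \<le> \<eta> e x * (D (x + w) - D x)"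
      unfolding \<zeta>_def \<eta>_def by (rule concave_quotient_tangent) (use that D_nonneg in auto)
    also have "\<dots> \<le> \<eta> e x * (2 * (z x \<bullet> w) + w \<bullet> w)"
      using D_shift[of x w] \<eta>_nonneg[OF that] by (intro mult_left_mono) auto
    finally show ?thesis .
  qed

  \<comment> \<open>The radius leaves room for translations of length at most 1, so the translated
    integrands vanish off \<open>W\<close> too.\<close>
  define W where "W = ball (0::'a) (R + 2)"
  have [measurable]: "W \<in> sets borel" by (simp add: W_def)
  have notW: "x + w \<notin> \<Omega>" if "x \<notin> W" "norm w \<le> 1" for x w
    using that R norm_triangle_ineq4[of "x + w" w] by (force simp: W_def)
  \<comment> \<open>\<open>lhs\<close> holds the tested difference quotients. \<open>rhs\<close>
    majorises the integrand obtained by moving the differences to the cutoff, so the two are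
    compared through their integrals and not pointwise.\<close>
  define lhs where "lhs e h x = (\<Sum>b\<in>Basis. \<zeta> e x * ((G (x - h *\<^sub>R b) - G x) \<bullet> b) / h)" for e h x
  define rhs where "rhs e h x = indicator W x * (2 * L * (\<eta> e x * D x) + 3 * M * real DIM('a) * (h / e))" for e h x

  have int: "integrable lborel f" if "f \<in> borel_measurable borel" "\<And>x. \<bar>f x\<bar> \<le> K" "\<And>x. x \<notin> W \<Longrightarrow> f x = 0"
    for f :: "'a \<Rightarrow> real" and K
    using integrable_lborel_bounded_support[OF that[unfolded W_def]] .
  have OW: "x \<notin> \<Omega>" if "x \<notin> W" for x using notW[OF that, of 0] by simp
  have int_\<zeta>: "integrable lborel (\<zeta> e)" if "0 < e" for e
    by (rule int[where K = 1]) (use \<zeta>_bounds[OF that] \<zeta>0 OW in auto)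
  have bdd: "\<bar>\<zeta> e x * (G y \<bullet> b)\<bar> \<le> M" if "b \<in> Basis" "0 < e" for e x y b
    using mult_mono[of "\<bar>\<zeta> e x\<bar>" 1 "\<bar>G y \<bullet> b\<bar>" M] Gb[OF that(1)] \<zeta>_bounds[OF that(2)] by (simp add: abs_mult)
  have lhs_le_rhs: "(\<integral>x. lhs e h x \<partial>lborel) \<le> (\<integral>x. rhs e h x \<partial>lborel)"
    if e: "0 < e" and h: "0 < h" "h \<le> 1" for e h
  proof -
    have int1: "integrable lborel (\<lambda>x. \<zeta> e x * (G (x - h *\<^sub>R b) \<bullet> b))" 
      and int2: "integrable lborel (\<lambda>x. \<zeta> e x * (G x \<bullet> b))"
      and int3: "integrable lborel (\<lambda>x. \<zeta> e (x + h *\<^sub>R b) * (G x \<bullet> b))" if "b \<in> Basis" for b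
      by (rule int[where K = M], measurable, rule bdd[OF that e], simp add: G0 \<zeta>0 OW)+
    have int4: "integrable lborel (\<lambda>x. \<zeta> e (x + w))" for w
      by (rule integrable_lborel_translate[OF int_\<zeta>[OF e]])
    \<comment> \<open>The increments of the cutoff are only bounded from above. Hence each component of the
      field is written as a difference of the nonnegative functions $F_b + M$ and $M$,
      and the cutoff is shifted forward against the first, backward against the second.\<close>
    define mid where "mid b x = (G x \<bullet> b + M) * (\<zeta> e (x + h *\<^sub>R b) - \<zeta> e x) + M * (\<zeta> e (x + - (h *\<^sub>R b)) - \<zeta> e x)"
      for b x
    have mid_eq: "mid b = (\<lambda>x. (\<zeta> e (x + h *\<^sub>R b) * (G x \<bullet> b) - \<zeta> e x * (G x \<bullet> b))
        + M * (\<zeta> e (x + h *\<^sub>R b) - \<zeta> e x) + M * (\<zeta> e (x + - (h *\<^sub>R b)) - \<zeta> e x))" for b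
      by (auto simp: mid_def algebra_simps)
    have int_mid: "integrable lborel (mid b)" if "b \<in> Basis" for b
      unfolding mid_eq by (intro Bochner_Integration.integrable_add Bochner_Integration.integrable_diff
          integrable_mult_right int2 int3 int4 int_\<zeta> e that)
    have mid: "(\<integral>x. \<zeta> e x * ((G (x - h *\<^sub>R b) - G x) \<bullet> b) \<partial>lborel) = (\<integral>x. mid b x \<partial>lborel)"
      if b: "b \<in> Basis" for b
    proof -
      have "(\<integral>x. \<zeta> e x * (G (x - h *\<^sub>R b) \<bullet> b) \<partial>lborel)
          = (\<integral>x. \<zeta> e (x + h *\<^sub>R b) * (G (x + h *\<^sub>R b - h *\<^sub>R b) \<bullet> b) \<partial>lborel)"
        by (rule integral_lborel_translate[symmetric]) measurable
      then have shift: "(\<integral>x. \<zeta> e x * (G (x - h *\<^sub>R b) \<bullet> b) \<partial>lborel) = (\<integral>x. \<zeta> e (x + h *\<^sub>R b) * (G x \<bullet> b) \<partial>lborel)"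
        by simp
      have same: "(\<integral>x. \<zeta> e (x + w) \<partial>lborel) = (\<integral>x. \<zeta> e x \<partial>lborel)" for w
        by (rule integral_lborel_translate) measurable
      show ?thesis
        unfolding mid_eq inner_diff_left right_diff_distrib
        using int1[OF b] int2[OF b] int3[OF b] int4 int4[of "- (h *\<^sub>R b)", simplified] int_\<zeta>[OF e]
        by (simp add: shift same same[of "- (h *\<^sub>R b)", simplified])
    qed
    have "(\<integral>x. lhs e h x \<partial>lborel) = (\<Sum>b\<in>Basis. (\<integral>x. \<zeta> e x * ((G (x - h *\<^sub>R b) - G x) \<bullet> b) \<partial>lborel) / h)"
      unfolding lhs_def 
      by (subst Bochner_Integration.integral_sum) (auto simp: inner_diff_left right_diff_distrib
          intro!: integrable_divide Bochner_Integration.integrable_diff int1 int2)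
    also have "\<dots> = (\<Sum>b\<in>Basis. (\<integral>x. mid b x \<partial>lborel) / h)" using mid by simp
    also have "\<dots> = (\<integral>x. (\<Sum>b\<in>Basis. mid b x / h) \<partial>lborel)"
      using int_mid by (subst Bochner_Integration.integral_sum) auto
    also have "\<dots> \<le> (\<integral>x. rhs e h x \<partial>lborel)"
    proof (rule integral_mono)
      show "integrable lborel (\<lambda>x. \<Sum>b\<in>Basis. mid b x / h)" using int_mid by auto
      show "integrable lborel (rhs e h)"
      proof (rule int[where K = "2 * L + 3 * M * real DIM('a) * (h / e)"])
        show "rhs e h \<in> borel_measurable borel"
          unfolding rhs_def \<eta>_def by measurable
        show "\<bar>rhs e h x\<bar> \<le> 2 * L + 3 * M * real DIM('a) * (h / e)" for x
        proof -
          have "0 \<le> 2 * L * (\<eta> e x * D x)" "2 * L * (\<eta> e x * D x) \<le> 2 * L * 1" "0 \<le> 3 * M * real DIM('a) * (h / e)"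
            using \<eta>_nonneg[OF e, of x] D_nonneg[of x] mult_left_mono[OF \<eta>D_le[OF e, of x], of "2 * L"] L(1) M(1) e h by simp_all
          then show ?thesis using L(1) by (auto simp: rhs_def indicator_def abs_le_iff)
        qed
      qed (auto simp: rhs_def)
      fix x
      show "(\<Sum>b\<in>Basis. mid b x / h) \<le> rhs e h x"
      proof (cases "x \<in> W")
        case False
        have "mid b x = 0" if "b \<in> Basis" for b
          using notW[OF False, of "h *\<^sub>R b"] notW[OF False, of "- (h *\<^sub>R b)"] OW[OF False] \<zeta>0 h that by (simp add: mid_def)
        then show ?thesis using False by (simp add: rhs_def)
      next
        case True
        have mid_le: "mid b x / h \<le> 2 * \<eta> e x * ((z x \<bullet> b) * (G x \<bullet> b)) + 3 * M * (h / e)" if b: "b \<in> Basis" for b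
        proof -
          have key: "\<eta> e x * (G x \<bullet> b + 2 * M) \<le> 1 / e * (3 * M)"
            using Gb[OF b, of x] \<eta>_le[OF e, of x] M(1) e by (intro mult_mono) auto
          \<comment> \<open>In the first-order terms the contributions of M cancel and leave 2 h (z
            . b) (G . b). The second-order terms add up to h^2 (G . b + 2 M), which is the source of
            the factor 3 M.\<close>
          have "mid b x \<le> (G x \<bullet> b + M) * (\<eta> e x * (2 * (z x \<bullet> (h *\<^sub>R b)) + (h *\<^sub>R b) \<bullet> (h *\<^sub>R b)))
              + M * (\<eta> e x * (2 * (z x \<bullet> (- (h *\<^sub>R b))) + (- (h *\<^sub>R b)) \<bullet> (- (h *\<^sub>R b))))"
            unfolding mid_def using Gb[OF b, of x] M(1)
            by (intro add_mono mult_left_mono \<zeta>_shift e) auto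
          also have "\<dots> = h * (2 * \<eta> e x * ((z x \<bullet> b) * (G x \<bullet> b)) + h * (\<eta> e x * (G x \<bullet> b + 2 * M)))"
            using b by (simp add: algebra_simps)
          also have "\<dots> \<le> h * (2 * \<eta> e x * ((z x \<bullet> b) * (G x \<bullet> b)) + h * (1 / e * (3 * M)))"
            using key h by (intro mult_left_mono add_left_mono) auto
          finally show ?thesis using h by (simp add: field_simps)
        qed
        have "(\<Sum>b\<in>Basis. mid b x / h) \<le> (\<Sum>b\<in>Basis. 2 * \<eta> e x * ((z x \<bullet> b) * (G x \<bullet> b)) + 3 * M * (h / e))"
          by (rule sum_mono[OF mid_le])
        also have "\<dots> = 2 * \<eta> e x * (G x \<bullet> z x) + 3 * M * real DIM('a) * (h / e)"
        proof -
          have "(\<Sum>b\<in>Basis. (z x \<bullet> b) * (G x \<bullet> b)) = G x \<bullet> z x"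
            by (subst inner_commute) (rule euclidean_inner[symmetric])
          then show ?thesis by (simp add: sum.distrib sum_distrib_left[symmetric])
        qed
        also have "\<dots> \<le> 2 * \<eta> e x * (L * D x) + 3 * M * real DIM('a) * (h / e)"
          using tangential[of x] \<eta>_nonneg[OF e, of x] D0[of x] by (intro add_right_mono mult_left_mono) (auto simp: G_def indicator_def)
        finally show ?thesis using True by (simp add: rhs_def algebra_simps)
      qed
    qed
    finally show ?thesis .
  qed

  \<comment> \<open>The step is coupled to the scale by h = (e k)^2. Then h / e k = e k tends to 0,
    and in the layer d x <= h the cutoff is at most h^2 / e k <= h. \<open>Suc\<close> keeps e k at
    most 1, hence also h <= 1 as the translations require.\<close>
  define e where "e k = 1 / real (Suc k)" for k
  have e: "0 < e k" "e k \<le> 1" for k by (auto simp: e_def)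
  have e_lim: "e \<longlonglongrightarrow> 0" unfolding e_def by (rule LIMSEQ_Suc[OF lim_1_over_n])
  have e2: "0 < (e k)\<^sup>2" "(e k)\<^sup>2 \<le> 1" "(e k)\<^sup>2 / e k = e k" for k
    using e[of k] power_le_one[of "e k" 2] by (auto simp: power2_eq_square)

  have lim_rhs: "(\<lambda>k. \<integral>x. rhs (e k) ((e k)\<^sup>2) x \<partial>lborel) \<longlonglongrightarrow> (\<integral>x. 0 \<partial>(lborel :: 'a measure))"
  proof (rule integral_dominated_convergence)
    show "integrable lborel (\<lambda>x. indicator W x * (2 * L + 3 * M * real DIM('a)))"
      by (rule int[where K = "\<bar>2 * L + 3 * M * real DIM('a)\<bar>"]) (auto simp: W_def indicator_def)
    show "rhs (e k) ((e k)\<^sup>2) \<in> borel_measurable lborel" for k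
      unfolding rhs_def \<eta>_def by measurable
    show "AE x in lborel. (\<lambda>k. rhs (e k) ((e k)\<^sup>2) x) \<longlonglongrightarrow> 0"
    proof (rule AE_I2)
      fix x
      have "(\<lambda>k. \<eta> (e k) x * D x) \<longlonglongrightarrow> 0"
      proof (cases "D x = 0")
        case False
        then have "(\<lambda>k. e k / (D x + e k)\<^sup>2 * D x) \<longlonglongrightarrow> 0 / (D x + 0)\<^sup>2 * D x"
          by (intro tendsto_intros e_lim) auto
        then show ?thesis by (simp add: \<eta>_def)
      qed simp
      then have "(\<lambda>k. indicator W x * (2 * L * (\<eta> (e k) x * D x) + 3 * M * real DIM('a) * e k))
          \<longlonglongrightarrow> indicator W x * (2 * L * 0 + 3 * M * real DIM('a) * 0)"
        by (intro tendsto_intros e_lim)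
      then show "(\<lambda>k. rhs (e k) ((e k)\<^sup>2) x) \<longlonglongrightarrow> 0" by (simp add: rhs_def e2)
    qed
    show "AE x in lborel. norm (rhs (e k) ((e k)\<^sup>2) x) \<le> indicator W x * (2 * L + 3 * M * real DIM('a))" for k
    proof (rule AE_I2)
      fix x
      have "0 \<le> 2 * L * (\<eta> (e k) x * D x)" "2 * L * (\<eta> (e k) x * D x) \<le> 2 * L * 1"
        "0 \<le> 3 * M * real DIM('a) * e k" "3 * M * real DIM('a) * e k \<le> 3 * M * real DIM('a) * 1"
        using \<eta>_nonneg[OF e(1)[of k], of x] D_nonneg[of x] L(1) M(1) e[of k]
          mult_left_mono[OF \<eta>D_le[OF e(1)[of k], of x], of "2 * L"] mult_left_mono[OF e(2)[of k], of "3 * M * real DIM('a)"]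
        by simp_all
      then show "norm (rhs (e k) ((e k)\<^sup>2) x) \<le> indicator W x * (2 * L + 3 * M * real DIM('a))"
        using L(1) by (auto simp: rhs_def e2 indicator_def abs_le_iff)
    qed
  qed simp

  define dv where "dv x = (\<Sum>b\<in>Basis. F' x b \<bullet> b)" for x
  have dv_cont: "continuous_on \<Omega> dv"
    unfolding dv_def by (intro continuous_intros continuous_on_subset[OF cF Osub])
  have lim_lhs: "(\<lambda>k. \<integral>x. lhs (e k) ((e k)\<^sup>2) x \<partial>lborel) \<longlonglongrightarrow> (\<integral>x. - (indicator \<Omega> x * dv x) \<partial>lborel)"
  proof (rule integral_dominated_convergence)
    show "(\<lambda>x. - (indicator \<Omega> x * dv x)) \<in> borel_measurable lborel"
      using borel_measurable_continuous_on_indicator[OF _ dv_cont] assms(1) by simp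
    show "integrable lborel (\<lambda>x. indicator \<Omega> x * (real DIM('a) * (L + 2 * M)))"
      by (rule int[where K = "\<bar>real DIM('a) * (L + 2 * M)\<bar>"], measurable) (auto simp: indicator_def OW)
    show "lhs (e k) ((e k)\<^sup>2) \<in> borel_measurable lborel" for k
      unfolding lhs_def by measurable
    show "AE x in lborel. (\<lambda>k. lhs (e k) ((e k)\<^sup>2) x) \<longlonglongrightarrow> - (indicator \<Omega> x * dv x)"
    proof (rule AE_I2)
      fix x
      show "(\<lambda>k. lhs (e k) ((e k)\<^sup>2) x) \<longlonglongrightarrow> - (indicator \<Omega> x * dv x)"
      proof (cases "x \<in> \<Omega>")
        case False
        then show ?thesis by (simp add: lhs_def \<zeta>0)
      next
        case True
        have "(\<lambda>k. D x / (D x + e k)) \<longlonglongrightarrow> D x / (D x + 0)"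
          by (intro tendsto_intros e_lim) (use D_pos[OF True] in auto)
        then have \<zeta>lim: "(\<lambda>k. \<zeta> (e k) x) \<longlonglongrightarrow> 1" using D_pos[OF True] by (simp add: \<zeta>_def)
        have "(F has_derivative F' x) (at x)"
          using dF[of x] True Osub assms(1) interior_mono[OF Osub] by (metis at_within_interior interior_open subsetD)
        then have dG: "(G has_derivative F' x) (at x)"
          by (rule has_derivative_transform_within_open[OF _ assms(1) True]) (simp add: G_def)
        have quot: "(\<lambda>k. (G (x - (e k)\<^sup>2 *\<^sub>R b) - G x) \<bullet> b / (e k)\<^sup>2) \<longlonglongrightarrow> - (F' x b \<bullet> b)" for b
        proof -
          have "((\<lambda>s. x + s *\<^sub>R b) has_derivative (\<lambda>s. s *\<^sub>R b)) (at 0)"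
            by (auto intro!: derivative_eq_intros)
          then have "((\<lambda>s. G (x + s *\<^sub>R b)) has_derivative (\<lambda>s. F' x (s *\<^sub>R b))) (at 0)"
            using has_derivative_compose[of "\<lambda>s. x + s *\<^sub>R b" "\<lambda>s. s *\<^sub>R b" 0 UNIV G "F' x"] dG by simp
          then have "((\<lambda>s. G (x + s *\<^sub>R b) \<bullet> b) has_derivative (\<lambda>s. F' x (s *\<^sub>R b) \<bullet> b)) (at 0)"
            by (intro has_derivative_inner_left)
          also have "(\<lambda>s. F' x (s *\<^sub>R b) \<bullet> b) = (*) (F' x b \<bullet> b)"
            using has_derivative_linear[OF dG] by (auto simp: linear_cmul)
          finally have "((\<lambda>s. (G (x + s *\<^sub>R b) \<bullet> b - G x \<bullet> b) / s) \<longlongrightarrow> F' x b \<bullet> b) (at 0)"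
            by (simp add: has_field_derivative_def[symmetric] has_field_derivative_iff)
          moreover have "filterlim (\<lambda>k. - (e k)\<^sup>2) (at 0) sequentially"
            using tendsto_minus[OF tendsto_power[OF e_lim, of 2]] e by (auto simp: filterlim_at less_imp_neq[THEN not_sym])
          ultimately have "(\<lambda>k. (G (x + (- (e k)\<^sup>2) *\<^sub>R b) \<bullet> b - G x \<bullet> b) / (- (e k)\<^sup>2)) \<longlonglongrightarrow> F' x b \<bullet> b"
            by (rule filterlim_compose)
          from tendsto_minus[OF this] show ?thesis by (simp add: inner_diff_left)
        qed
        have "(\<lambda>k. \<Sum>b\<in>Basis. \<zeta> (e k) x * ((G (x - (e k)\<^sup>2 *\<^sub>R b) - G x) \<bullet> b / (e k)\<^sup>2))
            \<longlonglongrightarrow> (\<Sum>b\<in>Basis. 1 * - (F' x b \<bullet> b))"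
          by (intro tendsto_sum tendsto_mult \<zeta>lim quot)
        then show ?thesis using True by (simp add: lhs_def dv_def sum_negf)
      qed
    qed
    show "AE x in lborel. norm (lhs (e k) ((e k)\<^sup>2) x) \<le> indicator \<Omega> x * (real DIM('a) * (L + 2 * M))" for k
    proof (rule AE_I2)
      fix x
      show "norm (lhs (e k) ((e k)\<^sup>2) x) \<le> indicator \<Omega> x * (real DIM('a) * (L + 2 * M))"
      proof (cases "x \<in> \<Omega>")
        case False
        then show ?thesis by (simp add: lhs_def \<zeta>0)
      next
        case True
        have "norm (lhs (e k) ((e k)\<^sup>2) x) \<le> (\<Sum>b\<in>(Basis :: 'a set). L + 2 * M)"
          unfolding lhs_def
        proof (rule sum_norm_le)
          fix b :: 'a assume b: "b \<in> Basis"
          define h where "h = (e k)\<^sup>2"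
          have h: "0 < h" using e2 by (simp add: h_def)
          define g where "g = (G (x - h *\<^sub>R b) - G x) \<bullet> b"
          \<comment> \<open>If h < d x, both points lie in the ball on which F is Lipschitz. In the
            remaining layer the difference of the field is only bounded by 2 M, but the cutoff is at
            most h there, which absorbs the later division by h.\<close>
          have "\<zeta> (e k) x * \<bar>g\<bar> \<le> (L + 2 * M) * h"
          proof (cases "h < d x")
            case True
            then have "x - h *\<^sub>R b \<in> ball x (d x)" using b h by (simp add: dist_norm)
            then have "x - h *\<^sub>R b \<in> \<Omega>" using ballO[of x] by blast
            then have "norm (G (x - h *\<^sub>R b) - G x) \<le> L * h"
              using ballO[of x] lip[OF \<open>x \<in> \<Omega>\<close>, of "x - h *\<^sub>R b"] b h True \<open>x \<in> \<Omega>\<close>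
              by (auto simp: G_def dist_norm)
            then have "\<bar>g\<bar> \<le> L * h" using Basis_le_norm[OF b, of "G (x - h *\<^sub>R b) - G x"] by (simp add: g_def)
            then have "\<zeta> (e k) x * \<bar>g\<bar> \<le> 1 * (L * h)"
              using \<zeta>_bounds[OF e(1), of k x] by (intro mult_mono) auto
            also have "\<dots> \<le> (L + 2 * M) * h" using M(1) h by (simp add: algebra_simps)
            finally show ?thesis .
          next
            case False
            then have "D x \<le> h * h" using d_nonneg[of x] unfolding D_def power2_eq_square by (intro mult_mono) auto
            then have "\<zeta> (e k) x \<le> h * h / e k"
              using \<zeta>_bounds(3)[OF e(1), of k x] e(1)[of k] by (meson divide_right_mono less_imp_le order_trans)
            also have "\<dots> = h * (h / e k)" by simp
            also have "\<dots> \<le> h * 1" using e2[of k] e[of k] h by (intro mult_left_mono) (auto simp: h_def)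
            finally have "\<zeta> (e k) x \<le> h" by simp
            moreover have "\<bar>g\<bar> \<le> 2 * M"
              using Gb[OF b, of x] Gb[OF b, of "x - h *\<^sub>R b"] by (simp add: g_def inner_diff_left)
            ultimately have "\<zeta> (e k) x * \<bar>g\<bar> \<le> h * (2 * M)" using h by (intro mult_mono) auto
            also have "\<dots> \<le> (L + 2 * M) * h"
            proof -
              have "0 \<le> L * h" using L(1) h by simp
              then show ?thesis by (simp add: algebra_simps)
            qed
            finally show ?thesis .
          qed
          then show "norm (\<zeta> (e k) x * ((G (x - (e k)\<^sup>2 *\<^sub>R b) - G x) \<bullet> b) / (e k)\<^sup>2) \<le> L + 2 * M"
            using h \<zeta>_bounds(1)[OF e(1), of k x] unfolding h_def[symmetric] g_def[symmetric]
            by (simp add: abs_mult divide_le_eq)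
        qed
        then show ?thesis using True by simp
      qed
    qed
  qed
  have "(\<integral>x. - (indicator \<Omega> x * dv x) \<partial>lborel) \<le> (\<integral>x. 0 \<partial>(lborel :: 'a measure))"
    by (rule LIMSEQ_le[OF lim_lhs lim_rhs]) (use lhs_le_rhs e e2 in blast)
  then show ?thesis
    using integral_lebesgue_on_open[OF assms(1) dv_cont] by (simp add: dv_def)
qed

text \<open>The hypotheses are invariant under F -> -F, so the one-sided estimate holds with both
  signs.\<close>

lemma integral_divergence_eq_0:
  fixes F :: "'a::euclidean_space \<Rightarrow> 'a"
  assumes "open \<Omega>" "bounded \<Omega>" and \<nu>: "\<And>x. x \<in> frontier \<Omega> \<Longrightarrow> exterior_unit_normal_at \<Omega> x (\<nu> x)"
    and dF: "\<And>x. x \<in> closure \<Omega> \<Longrightarrow> (F has_derivative F' x) (at x within closure \<Omega>)"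
    and cF: "\<And>b. b \<in> Basis \<Longrightarrow> continuous_on (closure \<Omega>) (\<lambda>x. F' x b)"
    and tang: "\<And>x. x \<in> frontier \<Omega> \<Longrightarrow> F x \<bullet> \<nu> x = 0"
  shows "(\<integral>x. (\<Sum>b\<in>Basis. F' x b \<bullet> b) \<partial>lebesgue_on \<Omega>) = 0"
proof -
  have "0 \<le> (\<integral>x. (\<Sum>b\<in>Basis. (- F' x b) \<bullet> b) \<partial>lebesgue_on \<Omega>)"
    by (rule integral_divergence_nonneg[where F = "\<lambda>x. - F x" and \<nu> = \<nu>])
      (use assms in \<open>auto intro: has_derivative_minus continuous_on_minus\<close>)
  moreover have "0 \<le> (\<integral>x. (\<Sum>b\<in>Basis. F' x b \<bullet> b) \<partial>lebesgue_on \<Omega>)"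
    by (rule integral_divergence_nonneg[where F = F and \<nu> = \<nu>]) (use assms in auto)
  ultimately show ?thesis by (simp add: sum_negf)
qed

section \<open>Integration by parts for the porous medium operator\<close>

lemma integrable_lebesgue_on_of_continuous_closure:
  fixes f :: "'a::euclidean_space \<Rightarrow> real"
  assumes "open \<Omega>" "bounded \<Omega>" "continuous_on (closure \<Omega>) f"
  shows "integrable (lebesgue_on \<Omega>) f"
proof -
  have \<Omega>: "\<Omega> \<in> lmeasurable" using assms by (simp add: lmeasurable_open)
  then interpret finite_measure "lebesgue_on \<Omega>" by (rule finite_measure_lebesgue_on)
  obtain B where B: "\<And>x. x \<in> closure \<Omega> \<Longrightarrow> norm (f x) \<le> B"
    using continuous_on_compact_obtain_bound[OF _ assms(3)] assms(2) by (auto simp: compact_closure)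
  show ?thesis
  proof (rule integrable_const_bound)
    show "AE x in lebesgue_on \<Omega>. norm (f x) \<le> B"
      using B closure_subset[of \<Omega>] by (intro AE_I2) auto
    show "f \<in> borel_measurable (lebesgue_on \<Omega>)"
      using \<Omega> by (intro continuous_imp_measurable_on_sets_lebesgue continuous_on_subset[OF assms(3) closure_subset]) auto
  qed
qed

lemma C_k_on_1_E:
  assumes "C_k_on 1 S f"
  obtains f' where "\<And>x. x \<in> S \<Longrightarrow> (f has_derivative f' x) (at x within S)" "\<And>v. continuous_on S (\<lambda>x. f' x v)"
proof -
  have "\<exists>f'. (\<forall>x\<in>S. (f has_derivative f' x) (at x within S)) \<and> (\<forall>v. continuous_on S (\<lambda>x. f' x v))"
    using assms by simp
  then obtain f' where "\<forall>x\<in>S. (f has_derivative f' x) (at x within S)" "\<forall>v. continuous_on S (\<lambda>x. f' x v)"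
    by (elim exE conjE)
  then show ?thesis using that[of f'] by simp
qed

text \<open>The field f \<phi> b vanishes on the frontier, because \<phi> is supported in a subset
  of the open set \<Omega>; hence it is tangential and its divergence integrates to 0. This makes
  the Poincare-Wirtinger hypothesis, which speaks of weak gradients, applicable to powers of the
  solution.\<close>

lemma has_weak_gradient_of_C1_closure:
  fixes f :: "'a::euclidean_space \<Rightarrow> real"
  assumes "open \<Omega>" "bounded \<Omega>" and \<nu>: "\<And>x. x \<in> frontier \<Omega> \<Longrightarrow> exterior_unit_normal_at \<Omega> x (\<nu> x)"
    and df: "\<And>x. x \<in> closure \<Omega> \<Longrightarrow> (f has_derivative (\<lambda>w. g x \<bullet> w)) (at x within closure \<Omega>)"
    and cg: "continuous_on (closure \<Omega>) g"
  shows "has_weak_gradient f g \<Omega>"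
  unfolding has_weak_gradient_def
proof safe
  fix \<phi> :: "'a \<Rightarrow> real" and b :: 'a
  assume b: "b \<in> Basis" and "test_function \<Omega> \<phi>"
  then obtain K where sm: "smooth_on UNIV \<phi>" and K: "K \<subseteq> \<Omega>" "\<And>x. x \<notin> K \<Longrightarrow> \<phi> x = 0"
    by (auto simp: test_function_def)
  obtain \<phi>' where \<phi>': "\<And>x. (\<phi> has_derivative \<phi>' x) (at x)" "\<And>v. continuous_on UNIV (\<lambda>x. \<phi>' x v)"
    using C_k_on_1_E[of UNIV \<phi>] sm unfolding smooth_on_def by auto
  have fr: "frechet_derivative \<phi> (at x) = \<phi>' x" for x
    using frechet_derivative_at[OF \<phi>'(1)] by simp
  have cf: "continuous_on (closure \<Omega>) f"
    by (rule has_derivative_continuous_on[OF df])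
  have c\<phi>: "continuous_on (closure \<Omega>) \<phi>"
    using \<phi>'(1) by (meson has_derivative_continuous continuous_at_imp_continuous_on)
  have c\<phi>': "continuous_on (closure \<Omega>) (\<lambda>x. \<phi>' x v)" for v
    by (rule continuous_on_subset[OF \<phi>'(2)]) auto
  define F' where "F' x w = (f x * \<phi>' x w + (g x \<bullet> w) * \<phi> x) *\<^sub>R b" for x w
  have "(\<integral>x. (\<Sum>c\<in>Basis. F' x c \<bullet> c) \<partial>lebesgue_on \<Omega>) = 0"
  proof (rule integral_divergence_eq_0[where F = "\<lambda>x. (f x * \<phi> x) *\<^sub>R b" and \<nu> = \<nu>])
    fix x assume x: "x \<in> closure \<Omega>"
    have "((\<lambda>x. f x * \<phi> x) has_derivative (\<lambda>w. f x * \<phi>' x w + (g x \<bullet> w) * \<phi> x)) (at x within closure \<Omega>)"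
      by (rule has_derivative_mult[OF df[OF x] has_derivative_at_withinI[OF \<phi>'(1)]])
    then show "((\<lambda>x. (f x * \<phi> x) *\<^sub>R b) has_derivative F' x) (at x within closure \<Omega>)"
      unfolding F'_def by (rule has_derivative_scaleR_left)
  next
    show "continuous_on (closure \<Omega>) (\<lambda>x. F' x c)" for c
      unfolding F'_def by (intro continuous_intros cf c\<phi> c\<phi>' cg)
  next
    fix x assume "x \<in> frontier \<Omega>"
    then have "x \<notin> K" using K(1) assms(1) by (auto simp: frontier_def interior_open)
    then show "(f x * \<phi> x) *\<^sub>R b \<bullet> \<nu> x = 0" using K(2) by simp
  qed (use assms in auto)
  also have "(\<lambda>x. \<Sum>c\<in>Basis. F' x c \<bullet> c) = (\<lambda>x. f x * \<phi>' x b + (g x \<bullet> b) * \<phi> x)"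
    unfolding F'_def using b by (auto simp: inner_Basis if_distrib sum.delta cong: if_cong)
  also have "(\<integral>x. f x * \<phi>' x b + (g x \<bullet> b) * \<phi> x \<partial>lebesgue_on \<Omega>)
      = (\<integral>x. f x * \<phi>' x b \<partial>lebesgue_on \<Omega>) + (\<integral>x. (g x \<bullet> b) * \<phi> x \<partial>lebesgue_on \<Omega>)"
    by (intro Bochner_Integration.integral_add integrable_lebesgue_on_of_continuous_closure assms
        continuous_intros cf c\<phi> c\<phi>' cg)
  finally show "(\<integral>x. f x * frechet_derivative \<phi> (at x) b \<partial>lebesgue_on \<Omega>)
      = - (\<integral>x. (g x \<bullet> b) * \<phi> x \<partial>lebesgue_on \<Omega>)"
    by (simp add: fr)
qed

text \<open>As \<Omega> has measure 1, the squared L^2 distance of f to its mean is the second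
  moment minus the square of the first. This is the shape in which the Beckner inequality takes its
  variance bound.\<close>

lemma poincare_wirtinger_variance:
  fixes f :: "'a::euclidean_space \<Rightarrow> real"
  assumes "open \<Omega>" "bounded \<Omega>" "measure lebesgue \<Omega> = 1"
    and \<nu>: "\<And>x. x \<in> frontier \<Omega> \<Longrightarrow> exterior_unit_normal_at \<Omega> x (\<nu> x)"
    and df: "\<And>x. x \<in> closure \<Omega> \<Longrightarrow> (f has_derivative (\<lambda>w. g x \<bullet> w)) (at x within closure \<Omega>)"
    and cg: "continuous_on (closure \<Omega>) g"
    and "poincare_wirtinger \<Omega> C" "0 < C"
  shows "(\<integral>x. (f x)\<^sup>2 \<partial>lebesgue_on \<Omega>) - (\<integral>x. f x \<partial>lebesgue_on \<Omega>)\<^sup>2 \<le> C\<^sup>2 * (\<integral>x. (norm (g x))\<^sup>2 \<partial>lebesgue_on \<Omega>)"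
proof -
  have \<Omega>: "\<Omega> \<in> lmeasurable" using assms by (simp add: lmeasurable_open)
  have cf: "continuous_on (closure \<Omega>) f"
    by (rule has_derivative_continuous_on[OF df])
  note int = integrable_lebesgue_on_of_continuous_closure[OF assms(1,2)]
  define m where "m = (\<integral>x. f x \<partial>lebesgue_on \<Omega>)"
  have "square_integrable_on f \<Omega>"
    unfolding square_integrable_on_def real_norm_def power2_abs
    by (intro conjI int borel_measurable_integrable[OF int] continuous_intros cf)
  moreover have "square_integrable_on g \<Omega>"
    unfolding square_integrable_on_def using \<Omega>
    by (intro conjI int continuous_intros cg continuous_imp_measurable_on_sets_lebesgue continuous_on_subset[OF cg closure_subset]) auto
  moreover have "has_weak_gradient f g \<Omega>"
    by (rule has_weak_gradient_of_C1_closure[where \<nu> = \<nu>]) (use assms in auto)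
  ultimately have "L2norm_on \<Omega> (\<lambda>x. f x - m) \<le> C * L2norm_on \<Omega> g"
    using assms(7) unfolding poincare_wirtinger_def m_def by blast
  then have "sqrt (\<integral>x. (f x - m)\<^sup>2 \<partial>lebesgue_on \<Omega>) \<le> C * sqrt (\<integral>x. (norm (g x))\<^sup>2 \<partial>lebesgue_on \<Omega>)"
    by (simp add: L2norm_on_def)
  also have "\<dots> = sqrt (C\<^sup>2 * (\<integral>x. (norm (g x))\<^sup>2 \<partial>lebesgue_on \<Omega>))"
    using \<open>0 < C\<close> by (simp add: real_sqrt_mult)
  finally have "(\<integral>x. (f x - m)\<^sup>2 \<partial>lebesgue_on \<Omega>) \<le> C\<^sup>2 * (\<integral>x. (norm (g x))\<^sup>2 \<partial>lebesgue_on \<Omega>)"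
    by simp
  moreover have "(\<integral>x. (f x - m)\<^sup>2 \<partial>lebesgue_on \<Omega>) = (\<integral>x. (f x)\<^sup>2 \<partial>lebesgue_on \<Omega>) - m\<^sup>2"
  proof -
    have "(\<integral>x. (f x - m)\<^sup>2 \<partial>lebesgue_on \<Omega>) = (\<integral>x. ((f x)\<^sup>2 - 2 * m * f x) + m\<^sup>2 \<partial>lebesgue_on \<Omega>)"
      by (simp add: power2_diff algebra_simps)
    also have "\<dots> = (\<integral>x. (f x)\<^sup>2 - 2 * m * f x \<partial>lebesgue_on \<Omega>) + (\<integral>x. m\<^sup>2 \<partial>lebesgue_on \<Omega>)"
      by (intro Bochner_Integration.integral_add int continuous_intros cf)
    also have "(\<integral>x. m\<^sup>2 \<partial>lebesgue_on \<Omega>) = m\<^sup>2"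
      using assms(3) \<Omega> by (simp add: measure_restrict_space)
    also have "(\<integral>x. (f x)\<^sup>2 - 2 * m * f x \<partial>lebesgue_on \<Omega>)
        = (\<integral>x. (f x)\<^sup>2 \<partial>lebesgue_on \<Omega>) - (\<integral>x. 2 * m * f x \<partial>lebesgue_on \<Omega>)"
      by (intro Bochner_Integration.integral_diff int continuous_intros cf)
    finally show ?thesis by (simp add: m_def[symmetric] power2_eq_square)
  qed
  ultimately show ?thesis by (simp add: m_def)
qed

lemma has_derivative_powr_const:
  fixes v :: "'a::real_normed_vector \<Rightarrow> real"
  assumes "(v has_derivative v') (at x within S)" "0 < v x"
  shows "((\<lambda>y. v y powr r) has_derivative (\<lambda>w. r * v x powr (r - 1) * v' w)) (at x within S)"
proof -
  have "((\<lambda>s. s powr r) has_derivative (\<lambda>h. r * v x powr (r - 1) * h)) (at (v x))"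
    using has_real_derivative_powr[OF assms(2), of r] by (simp add: has_field_derivative_def)
  from has_derivative_compose[OF assms(1) this] show ?thesis .
qed

text \<open>\<open>frechet_derivative\<close> selects some derivative within the closure; the
  exterior normal leaves only one candidate, so the Neumann condition can be read with the computed
  gradient.\<close>

lemma gradient_within_unique:
  fixes f :: "'a::euclidean_space \<Rightarrow> real"
  assumes "exterior_unit_normal_at \<Omega> x n" "x \<in> closure \<Omega>"
    and "(f has_derivative (\<lambda>w. g \<bullet> w)) (at x within closure \<Omega>)"
  shows "gradient_within f (closure \<Omega>) x = g"
proof -
  have "f differentiable (at x within closure \<Omega>)" using assms(3) by (auto simp: differentiable_def)
  then have "(f has_derivative frechet_derivative f (at x within closure \<Omega>)) (at x within closure \<Omega>)"
    by (simp add: frechet_derivative_works)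
  then have "frechet_derivative f (at x within closure \<Omega>) = (\<lambda>w. g \<bullet> w)"
    by (rule has_derivative_within_unique_of_normal[OF assms(1) closure_subset assms(2) _ assms(3)])
  then show ?thesis by (simp add: gradient_within_def euclidean_representation)
qed

text \<open>The chain rule applied twice, with H the Hessian of v and its trace the Laplacian of v.
  The right-hand side makes sense up to the boundary, whereas \<open>laplacian\<close> uses full
  derivatives and is evaluated inside \<Omega> only.\<close>

lemma laplacian_powr:
  fixes v :: "'a::euclidean_space \<Rightarrow> real"
  assumes "open \<Omega>" and x: "x \<in> \<Omega>" and pos: "\<And>y. y \<in> \<Omega> \<Longrightarrow> 0 < v y"
    and dv: "\<And>y. y \<in> \<Omega> \<Longrightarrow> (v has_derivative (\<lambda>w. g y \<bullet> w)) (at y)"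
    and dg: "(g has_derivative H) (at x)"
  shows "laplacian (\<lambda>y. v y powr \<beta>) x
    = \<beta> * (\<beta> - 1) * v x powr (\<beta> - 2) * (norm (g x))\<^sup>2 + \<beta> * v x powr (\<beta> - 1) * (\<Sum>b\<in>Basis. H b \<bullet> b)"
proof -
  have first: "frechet_derivative (\<lambda>y. v y powr \<beta>) (at y) b = \<beta> * v y powr (\<beta> - 1) * (g y \<bullet> b)"
    if "y \<in> \<Omega>" for y b
    using frechet_derivative_at[OF has_derivative_powr_const[OF dv pos, OF that that, of \<beta>]] by (metis (no_types))
  have second: "frechet_derivative (\<lambda>y. frechet_derivative (\<lambda>y. v y powr \<beta>) (at y) b) (at x) b
      = \<beta> * (\<beta> - 1) * v x powr (\<beta> - 2) * ((g x \<bullet> b) * (g x \<bullet> b)) + \<beta> * v x powr (\<beta> - 1) * (H b \<bullet> b)" for b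
  proof -
    have "((\<lambda>y. \<beta> * v y powr (\<beta> - 1)) has_derivative (\<lambda>w. \<beta> * ((\<beta> - 1) * v x powr (\<beta> - 1 - 1) * (g x \<bullet> w)))) (at x)"
      by (intro has_derivative_mult_right has_derivative_powr_const dv pos x)
    from has_derivative_mult[OF this has_derivative_inner_left[OF dg, of b]]
    have "((\<lambda>y. \<beta> * v y powr (\<beta> - 1) * (g y \<bullet> b)) has_derivative
        (\<lambda>w. \<beta> * v x powr (\<beta> - 1) * (H w \<bullet> b) + \<beta> * ((\<beta> - 1) * v x powr (\<beta> - 1 - 1) * (g x \<bullet> w)) * (g x \<bullet> b))) (at x)" .
    then have "((\<lambda>y. frechet_derivative (\<lambda>y. v y powr \<beta>) (at y) b) has_derivative
        (\<lambda>w. \<beta> * v x powr (\<beta> - 1) * (H w \<bullet> b) + \<beta> * ((\<beta> - 1) * v x powr (\<beta> - 1 - 1) * (g x \<bullet> w)) * (g x \<bullet> b))) (at x)"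
      by (rule has_derivative_transform_within_open[OF _ assms(1) x]) (simp add: first)
    from frechet_derivative_at[OF this, symmetric] show ?thesis by (simp add: algebra_simps)
  qed
  have "laplacian (\<lambda>y. v y powr \<beta>) x
      = \<beta> * (\<beta> - 1) * v x powr (\<beta> - 2) * (\<Sum>b\<in>Basis. (g x \<bullet> b) * (g x \<bullet> b)) + \<beta> * v x powr (\<beta> - 1) * (\<Sum>b\<in>Basis. H b \<bullet> b)"
    unfolding laplacian_def second by (simp add: sum.distrib sum_distrib_left)
  then show ?thesis by (simp add: euclidean_inner[symmetric] power2_norm_eq_inner)
qed

text \<open>The field is v^a times the gradient of v^\<beta>, that is \<beta> v^(a + \<beta> - 1) g.
  On the frontier it is a positive multiple of the gradient of v^\<beta>, so the Neumann condition
  makes it tangential. Its divergence consists of the integrand on the left and a \<beta> times the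
  one on the right.\<close>

lemma integral_powr_mult_laplacian_powr:
  fixes v :: "'a::euclidean_space \<Rightarrow> real"
  assumes "open \<Omega>" "bounded \<Omega>" "0 < \<beta>" and \<nu>: "\<And>x. x \<in> frontier \<Omega> \<Longrightarrow> exterior_unit_normal_at \<Omega> x (\<nu> x)"
    and pos: "\<And>y. y \<in> closure \<Omega> \<Longrightarrow> 0 < v y"
    and dv: "\<And>y. y \<in> closure \<Omega> \<Longrightarrow> (v has_derivative (\<lambda>w. g y \<bullet> w)) (at y within closure \<Omega>)"
    and dg: "\<And>y. y \<in> closure \<Omega> \<Longrightarrow> (g has_derivative H y) (at y within closure \<Omega>)"
    and cH: "\<And>w. continuous_on (closure \<Omega>) (\<lambda>y. H y w)"
    and neumann: "\<And>x. x \<in> frontier \<Omega> \<Longrightarrow> gradient_within (\<lambda>y. v y powr \<beta>) (closure \<Omega>) x \<bullet> \<nu> x = 0"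
  shows "(\<integral>x. v x powr a * laplacian (\<lambda>y. v y powr \<beta>) x \<partial>lebesgue_on \<Omega>)
    = - (a * \<beta>) * (\<integral>x. v x powr (a + \<beta> - 2) * (norm (g x))\<^sup>2 \<partial>lebesgue_on \<Omega>)"
proof -
  have cv: "continuous_on (closure \<Omega>) v" by (rule has_derivative_continuous_on[OF dv])
  have cg: "continuous_on (closure \<Omega>) g" by (rule has_derivative_continuous_on[OF dg])
  have v0: "\<forall>x\<in>closure \<Omega>. v x \<noteq> 0" using pos by force
  have Osub: "\<Omega> \<subseteq> closure \<Omega>" by (rule closure_subset)
  have at: "at y within closure \<Omega> = at y" if "y \<in> \<Omega>" for y
    using at_within_interior[of y "closure \<Omega>"] interior_mono[OF Osub] that assms(1) by (auto simp: interior_open)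
  have laplacian_eq: "laplacian (\<lambda>y. v y powr \<beta>) x
      = \<beta> * (\<beta> - 1) * v x powr (\<beta> - 2) * (norm (g x))\<^sup>2 + \<beta> * v x powr (\<beta> - 1) * (\<Sum>b\<in>Basis. H x b \<bullet> b)"
    if x: "x \<in> \<Omega>" for x
  proof (rule laplacian_powr[OF assms(1) x])
    show "(g has_derivative H x) (at x)" using dg[of x] at[OF x] Osub x by auto
    fix y assume y: "y \<in> \<Omega>"
    show "0 < v y" using pos Osub y by blast
    show "(v has_derivative (\<lambda>w. g y \<bullet> w)) (at y)" using dv[of y] at[OF y] Osub y by auto
  qed
  define F' where "F' x w = (\<beta> * v x powr (a + \<beta> - 1)) *\<^sub>R H x w
      + (\<beta> * ((a + \<beta> - 1) * v x powr (a + \<beta> - 1 - 1) * (g x \<bullet> w))) *\<^sub>R g x" for x w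
  have "(\<integral>x. (\<Sum>c\<in>Basis. F' x c \<bullet> c) \<partial>lebesgue_on \<Omega>) = 0"
  proof (rule integral_divergence_eq_0[where F = "\<lambda>x. (\<beta> * v x powr (a + \<beta> - 1)) *\<^sub>R g x" and \<nu> = \<nu>])
    fix x assume x: "x \<in> closure \<Omega>"
    show "((\<lambda>x. (\<beta> * v x powr (a + \<beta> - 1)) *\<^sub>R g x) has_derivative F' x) (at x within closure \<Omega>)"
      unfolding F'_def
      by (intro has_derivative_scaleR has_derivative_mult_right has_derivative_powr_const dv dg pos x)
  next
    show "continuous_on (closure \<Omega>) (\<lambda>x. F' x c)" for c
      unfolding F'_def by (intro continuous_intros cv cg cH v0)
  next
    fix x assume x: "x \<in> frontier \<Omega>"
    then have xc: "x \<in> closure \<Omega>" by (simp add: frontier_def)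
    have "((\<lambda>y. v y powr \<beta>) has_derivative (\<lambda>w. ((\<beta> * v x powr (\<beta> - 1)) *\<^sub>R g x) \<bullet> w)) (at x within closure \<Omega>)"
      using has_derivative_powr_const[OF dv[OF xc] pos[OF xc], of \<beta>] by simp
    from gradient_within_unique[OF \<nu>[OF x] xc this] neumann[OF x]
    have "g x \<bullet> \<nu> x = 0" using \<open>0 < \<beta>\<close> pos[OF xc] by auto
    then show "(\<beta> * v x powr (a + \<beta> - 1)) *\<^sub>R g x \<bullet> \<nu> x = 0" by simp
  qed (use assms in auto)
  moreover have "(\<integral>x. (\<Sum>c\<in>Basis. F' x c \<bullet> c) \<partial>lebesgue_on \<Omega>)
      = (\<integral>x. v x powr a * laplacian (\<lambda>y. v y powr \<beta>) x + a * \<beta> * (v x powr (a + \<beta> - 2) * (norm (g x))\<^sup>2) \<partial>lebesgue_on \<Omega>)"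
  proof (rule Bochner_Integration.integral_cong[OF refl])
    fix x assume "x \<in> space (lebesgue_on \<Omega>)"
    then have x: "x \<in> \<Omega>" by simp
    then have vx: "0 < v x" using pos Osub by auto
    note lap = laplacian_eq[OF x]
    have "(\<Sum>c\<in>Basis. F' x c \<bullet> c) = \<beta> * v x powr (a + \<beta> - 1) * (\<Sum>b\<in>Basis. H x b \<bullet> b)
        + \<beta> * (a + \<beta> - 1) * v x powr (a + \<beta> - 1 - 1) * (\<Sum>b\<in>Basis. (g x \<bullet> b) * (g x \<bullet> b))"
      by (simp add: F'_def inner_add sum.distrib sum_distrib_left mult.assoc)
    also have "\<dots> = \<beta> * v x powr (a + \<beta> - 1) * (\<Sum>b\<in>Basis. H x b \<bullet> b)
        + \<beta> * (a + \<beta> - 1) * v x powr (a + \<beta> - 2) * (norm (g x))\<^sup>2"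
      by (simp add: euclidean_inner[symmetric] power2_norm_eq_inner)
    also have "v x powr (a + \<beta> - 1) = v x powr a * v x powr (\<beta> - 1)"
      by (simp add: powr_add[symmetric] algebra_simps)
    also have split: "v x powr (a + \<beta> - 2) = v x powr a * v x powr (\<beta> - 2)"
      by (simp add: powr_add[symmetric] algebra_simps)
    finally show "(\<Sum>c\<in>Basis. F' x c \<bullet> c)
        = v x powr a * laplacian (\<lambda>y. v y powr \<beta>) x + a * \<beta> * (v x powr (a + \<beta> - 2) * (norm (g x))\<^sup>2)"
      unfolding lap split by (simp add: algebra_simps)
  qed
  moreover have "\<dots> = (\<integral>x. v x powr a * laplacian (\<lambda>y. v y powr \<beta>) x \<partial>lebesgue_on \<Omega>)
      + (\<integral>x. a * \<beta> * (v x powr (a + \<beta> - 2) * (norm (g x))\<^sup>2) \<partial>lebesgue_on \<Omega>)"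
  proof (rule Bochner_Integration.integral_add)
    \<comment> \<open>The explicit formula is continuous on the closure and hence integrable;
      \<open>laplacian\<close> inherits this because the two agree on \<Omega>.\<close>
    have "integrable (lebesgue_on \<Omega>) (\<lambda>x. v x powr a * (\<beta> * (\<beta> - 1) * v x powr (\<beta> - 2) * (norm (g x))\<^sup>2
        + \<beta> * v x powr (\<beta> - 1) * (\<Sum>b\<in>Basis. H x b \<bullet> b)))"
      by (intro integrable_lebesgue_on_of_continuous_closure assms(1,2) continuous_intros cv cg cH v0)
    then show "integrable (lebesgue_on \<Omega>) (\<lambda>x. v x powr a * laplacian (\<lambda>y. v y powr \<beta>) x)"
      by (rule Bochner_Integration.integrable_cong[OF refl, THEN iffD1, rotated]) (simp add: laplacian_eq)
    show "integrable (lebesgue_on \<Omega>) (\<lambda>x. a * \<beta> * (v x powr (a + \<beta> - 2) * (norm (g x))\<^sup>2))"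
      by (intro integrable_lebesgue_on_of_continuous_closure assms(1,2) continuous_intros cv cg v0)
  qed
  ultimately show ?thesis by simp
qed

section \<open>Spatial and temporal derivatives from smoothness in space-time\<close>

lemma has_derivative_slices:
  fixes U :: "real \<times> 'a::euclidean_space \<Rightarrow> 'b::real_normed_vector"
  assumes U: "(U has_derivative U') (at (t, x) within T \<times> K)" and "t \<in> T" "x \<in> K"
  shows "((\<lambda>y. U (t, y)) has_derivative (\<lambda>w. U' (0, w))) (at x within K)"
    and "((\<lambda>s. U (s, x)) has_derivative (\<lambda>r. U' (r, 0))) (at t within T)"
proof -
  have 1: "(\<lambda>y. (t, y)) ` K \<subseteq> T \<times> K" "(\<lambda>s. (s, x)) ` T \<subseteq> T \<times> K" using assms by auto
  have "((\<lambda>y. (t, y)) has_derivative (\<lambda>w. (0, w))) (at x within K)"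
    "((\<lambda>s. (s, x)) has_derivative (\<lambda>r. (r, 0))) (at t within T)"
    by (auto intro!: derivative_eq_intros)
  from diff_chain_within[OF this(1) has_derivative_subset[OF U 1(1)]]
    diff_chain_within[OF this(2) has_derivative_subset[OF U 1(2)]]
  show "((\<lambda>y. U (t, y)) has_derivative (\<lambda>w. U' (0, w))) (at x within K)"
    and "((\<lambda>s. U (s, x)) has_derivative (\<lambda>r. U' (r, 0))) (at t within T)" by (simp_all add: o_def)
qed

text \<open>The joint derivative is read off along the directions (0, b) for the gradient and (1, 0)
  for the time derivative, and differentiating the former once more in space gives the Hessian. In
  time the derivatives are two-sided since the interval is open; in space they stay within
  K.\<close>

lemma smooth_on_spacetime_derivatives:
  fixes u :: "real \<Rightarrow> 'a::euclidean_space \<Rightarrow> real"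
  assumes "smooth_on ({0<..} \<times> K) (\<lambda>(t, x). u t x)"
  obtains g :: "real \<Rightarrow> 'a \<Rightarrow> 'a" and H :: "real \<Rightarrow> 'a \<Rightarrow> 'a \<Rightarrow> 'a" and ut :: "real \<Rightarrow> 'a \<Rightarrow> real"
  where "\<And>t x. 0 < t \<Longrightarrow> x \<in> K \<Longrightarrow> (u t has_derivative (\<lambda>w. g t x \<bullet> w)) (at x within K)"
    and "\<And>t x. 0 < t \<Longrightarrow> x \<in> K \<Longrightarrow> (g t has_derivative H t x) (at x within K)"
    and "\<And>t w. 0 < t \<Longrightarrow> continuous_on K (\<lambda>x. H t x w)"
    and "\<And>t x. 0 < t \<Longrightarrow> x \<in> K \<Longrightarrow> ((\<lambda>s. u s x) has_real_derivative ut t x) (at t)"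
    and "continuous_on ({0<..} \<times> K) (\<lambda>(t, x). ut t x)"
proof -
  define S U where "S = {0::real<..} \<times> K" and "U = (\<lambda>(t, x). u t x)"
  have "C_k_on (Suc 1) S U" using assms by (simp add: smooth_on_def S_def U_def)
  then obtain U' where U': "\<And>z. z \<in> S \<Longrightarrow> (U has_derivative U' z) (at z within S)"
    and "\<And>v. C_k_on 1 S (\<lambda>z. U' z v)"
    unfolding C_k_on.simps(2) by blast
  then have "\<exists>A. (\<forall>z\<in>S. ((\<lambda>z. U' z v) has_derivative A z) (at z within S)) \<and> (\<forall>w. continuous_on S (\<lambda>z. A z w))" for v
    by (metis C_k_on_1_E)
  then obtain A where A: "\<And>v z. z \<in> S \<Longrightarrow> ((\<lambda>z. U' z v) has_derivative A v z) (at z within S)"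
    and cA: "\<And>v w. continuous_on S (\<lambda>z. A v z w)" by metis
  have cU': "continuous_on S (\<lambda>z. U' z v)" for v
    by (rule has_derivative_continuous_on[OF A])
  show ?thesis
  proof
    fix t :: real and x assume t: "0 < t" and x: "x \<in> K"
    then have z: "(t, x) \<in> S" by (simp add: S_def)
    have lin: "linear (U' (t, x))" by (rule has_derivative_linear[OF U'[OF z]])
    have d1: "((\<lambda>y. U (t, y)) has_derivative (\<lambda>w. U' (t, x) (0, w))) (at x within K)"
      by (rule has_derivative_slices(1)[where T = "{0<..}"]) (use U'[OF z] t x in \<open>auto simp: S_def\<close>)
    define G where "G = (\<Sum>b\<in>Basis. U' (t, x) (0, b) *\<^sub>R b)"
    have dG: "U' (t, x) (0, w) = G \<bullet> w" for w
    proof -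
      have lin0: "linear (\<lambda>w. U' (t, x) (0, w))"
        using linear_compose[OF _ lin, of "\<lambda>w. (0, w)"] by (simp add: o_def linear_iff)
      have "U' (t, x) (0, w) = U' (t, x) (0, \<Sum>b\<in>Basis. (w \<bullet> b) *\<^sub>R b)" by (simp add: euclidean_representation)
      also have "\<dots> = (\<Sum>b\<in>Basis. (w \<bullet> b) * U' (t, x) (0, b))"
        using linear_sum[OF lin0, of "\<lambda>b. (w \<bullet> b) *\<^sub>R b" Basis] linear_cmul[OF lin0] by simp
      finally show ?thesis by (simp add: G_def inner_sum_right inner_commute[of _ w] mult.commute)
    qed
    from d1 show "(u t has_derivative (\<lambda>w. (\<Sum>b\<in>Basis. U' (t, x) (0, b) *\<^sub>R b) \<bullet> w)) (at x within K)"
      unfolding G_def[symmetric] dG by (simp add: U_def euclidean_representation)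
    have "((\<lambda>y. U' (t, y) (0, b)) has_derivative (\<lambda>w. A (0, b) (t, x) (0, w))) (at x within K)" for b
      by (rule has_derivative_slices(1)[where T = "{0<..}"]) (use A[OF z] t x in \<open>auto simp: S_def\<close>)
    then show "((\<lambda>x. \<Sum>b\<in>Basis. U' (t, x) (0, b) *\<^sub>R b) has_derivative
        (\<lambda>w. \<Sum>b\<in>Basis. A (0, b) (t, x) (0, w) *\<^sub>R b)) (at x within K)"
      by (intro has_derivative_sum has_derivative_scaleR_left)
    have d: "((\<lambda>s. U (s, x)) has_derivative (\<lambda>r. U' (t, x) (r, 0))) (at t within {0<..})"
      by (rule has_derivative_slices(2)[where K = K]) (use U'[OF z] t x in \<open>auto simp: S_def\<close>)
    have "(\<lambda>r. U' (t, x) (r, 0)) = (*) (U' (t, x) (1, 0))"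
    proof
      show "U' (t, x) (r, 0) = U' (t, x) (1, 0) * r" for r
        using linear_cmul[OF lin, of r "(1, 0)"] by simp
    qed
    from d[unfolded this] show "((\<lambda>s. u s x) has_real_derivative U' (t, x) (1, 0)) (at t)"
      using at_within_open[of t "{0<..}"] t by (simp add: U_def has_field_derivative_def)
  next
    fix t :: real and w assume "0 < t"
    then show "continuous_on K (\<lambda>x. \<Sum>b\<in>Basis. A (0, b) (t, x) (0, w) *\<^sub>R b)"
      by (intro continuous_intros continuous_on_compose2[OF cA, of _ "\<lambda>x. (t, x)"]) (auto simp: S_def)
  next
    show "continuous_on ({0<..} \<times> K) (\<lambda>(t, x). U' (t, x) (1, 0))"
      using cU'[of "(1, 0)"] by (simp add: S_def split_def)
  qed
qed

section \<open>Entropy decay\<close>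

lemma continuous_on_slices:
  fixes f :: "'b::topological_space \<Rightarrow> 'c::topological_space \<Rightarrow> 'd::topological_space"
  assumes "continuous_on (T \<times> K) (\<lambda>(s, x). f s x)"
  shows "s \<in> T \<Longrightarrow> continuous_on K (f s)" and "x \<in> K \<Longrightarrow> continuous_on T (\<lambda>s. f s x)"
proof -
  assume "s \<in> T"
  then have "continuous_on K (\<lambda>x. case (s, x) of (s, x) \<Rightarrow> f s x)"
    by (intro continuous_on_compose2[OF assms] continuous_on_Pair continuous_on_const continuous_on_id) auto
  then show "continuous_on K (f s)" by simp
next
  assume "x \<in> K"
  then have "continuous_on T (\<lambda>s. case (s, x) of (s, x) \<Rightarrow> f s x)"
    by (intro continuous_on_compose2[OF assms] continuous_on_Pair continuous_on_const continuous_on_id) auto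
  then show "continuous_on T (\<lambda>s. f s x)" by simp
qed

lemma has_real_derivative_integral_lebesgue_on:
  fixes f f' :: "real \<Rightarrow> 'a::euclidean_space \<Rightarrow> real"
  assumes "open \<Omega>" "bounded \<Omega>" and t: "0 < t"
    and cf: "\<And>s. 0 < s \<Longrightarrow> continuous_on (closure \<Omega>) (f s)"
    and df: "\<And>s x. 0 < s \<Longrightarrow> x \<in> \<Omega> \<Longrightarrow> ((\<lambda>s. f s x) has_real_derivative f' s x) (at s)"
    and cf': "continuous_on ({0<..} \<times> closure \<Omega>) (\<lambda>(s, x). f' s x)"
  shows "((\<lambda>s. \<integral>x. f s x \<partial>lebesgue_on \<Omega>) has_real_derivative (\<integral>x. f' t x \<partial>lebesgue_on \<Omega>)) (at t)"
proof -
  \<comment> \<open>A compact neighbourhood of t away from 0. The time derivative is continuous at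
    positive times, so it is bounded on \<open>T \<times> closure \<Omega>\<close>, and this bound
    dominates the difference quotients.\<close>
  define T where "T = {t / 2..2 * t}"
  have T_pos: "0 < s" if "s \<in> T" for s using that t by (auto simp: T_def)
  have tT: "t \<in> interior T" using t by (simp add: T_def)
  note int = integrable_lebesgue_on_of_continuous_closure[OF assms(1,2)]
  have cont_t: "continuous_on (closure \<Omega>) (f' s)" if "0 < s" for s
    by (rule continuous_on_slices(1)[OF cf']) (use that in simp)
  have sub: "T \<times> closure \<Omega> \<subseteq> {0<..} \<times> closure \<Omega>" using T_pos by auto
  have "compact (T \<times> closure \<Omega>)"
    using assms(2) by (intro compact_Times) (simp_all add: T_def compact_closure)
  then obtain B where B0: "\<And>z. z \<in> T \<times> closure \<Omega> \<Longrightarrow> norm (case z of (s, x) \<Rightarrow> f' s x) \<le> B"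
    using continuous_on_compact_obtain_bound[OF _ continuous_on_subset[OF cf' sub]] by blast
  have B: "\<bar>f' s x\<bar> \<le> B" if "s \<in> T" "x \<in> closure \<Omega>" for s x
    using B0[of "(s, x)"] that by simp
  have lip: "\<bar>f s x - f t x\<bar> \<le> B * \<bar>s - t\<bar>" if "s \<in> T" "x \<in> \<Omega>" for s x
  proof -
    have "norm (f s x - f t x) \<le> B * norm (s - t)"
    proof (rule field_differentiable_bound[where S = T and f = "\<lambda>s. f s x"])
      fix r assume r: "r \<in> T"
      show "((\<lambda>s. f s x) has_field_derivative f' r x) (at r within T)"
        by (rule has_field_derivative_at_within[OF df[OF T_pos[OF r] that(2)]])
      show "norm (f' r x) \<le> B" using B[OF r] that closure_subset[of \<Omega>] by auto
    qed (use that tT interior_subset in \<open>auto simp: T_def\<close>)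
    then show ?thesis by simp
  qed
  have "((\<lambda>s. ((\<integral>x. f s x \<partial>lebesgue_on \<Omega>) - (\<integral>x. f t x \<partial>lebesgue_on \<Omega>)) / (s - t))
      \<longlongrightarrow> (\<integral>x. f' t x \<partial>lebesgue_on \<Omega>)) (at t within T)"
    unfolding tendsto_at_iff_sequentially
  proof safe
    fix X :: "nat \<Rightarrow> real"
    assume XT: "\<forall>i. X i \<in> T - {t}" and X: "X \<longlonglongrightarrow> t"
    have "(\<lambda>i. \<integral>x. (f (X i) x - f t x) / (X i - t) \<partial>lebesgue_on \<Omega>) \<longlonglongrightarrow> (\<integral>x. f' t x \<partial>lebesgue_on \<Omega>)"
    proof (rule integral_dominated_convergence)
      show "f' t \<in> borel_measurable (lebesgue_on \<Omega>)"
        by (rule borel_measurable_integrable[OF int[OF cont_t[OF t]]])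
      show "integrable (lebesgue_on \<Omega>) (\<lambda>x. B)" by (rule int) (rule continuous_on_const)
      fix i
      have "0 < X i" using XT T_pos by auto
      then show "(\<lambda>x. (f (X i) x - f t x) / (X i - t)) \<in> borel_measurable (lebesgue_on \<Omega>)"
        using t XT by (intro borel_measurable_integrable[OF int] continuous_intros cf) auto
      show "AE x in lebesgue_on \<Omega>. norm ((f (X i) x - f t x) / (X i - t)) \<le> B"
        using lip XT by (intro AE_I2) (auto simp: abs_divide divide_le_eq)
    next
      show "AE x in lebesgue_on \<Omega>. (\<lambda>i. (f (X i) x - f t x) / (X i - t)) \<longlonglongrightarrow> f' t x"
      proof (rule AE_I2)
        fix x assume "x \<in> space (lebesgue_on \<Omega>)"
        then have "((\<lambda>s. (f s x - f t x) / (s - t)) \<longlongrightarrow> f' t x) (at t)"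
          using df[OF t, of x] by (simp add: has_field_derivative_iff)
        moreover have "filterlim X (at t) sequentially"
          using X XT by (auto simp: filterlim_at)
        ultimately show "(\<lambda>i. (f (X i) x - f t x) / (X i - t)) \<longlonglongrightarrow> f' t x"
          by (rule filterlim_compose)
      qed
    qed
    moreover have "(\<integral>x. (f (X i) x - f t x) / (X i - t) \<partial>lebesgue_on \<Omega>)
        = ((\<integral>x. f (X i) x \<partial>lebesgue_on \<Omega>) - (\<integral>x. f t x \<partial>lebesgue_on \<Omega>)) / (X i - t)" for i
    proof -
      have "0 < X i" using XT T_pos by auto
      then show ?thesis using int[OF cf[of "X i"]] int[OF cf[OF t]] by simp
    qed
    ultimately show "((\<lambda>s. ((\<integral>x. f s x \<partial>lebesgue_on \<Omega>) - (\<integral>x. f t x \<partial>lebesgue_on \<Omega>)) / (s - t)) \<circ> X)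
        \<longlonglongrightarrow> (\<integral>x. f' t x \<partial>lebesgue_on \<Omega>)"
      unfolding o_def by (simp only:)
  qed
  then show ?thesis by (simp add: has_field_derivative_iff at_within_interior[OF tT])
qed

text \<open>Used on intervals that include time 0, where only continuity of the solution is given;
  compactness supplies the dominating constant.\<close>

lemma continuous_on_integral_lebesgue_on:
  fixes f :: "real \<Rightarrow> 'a::euclidean_space \<Rightarrow> real"
  assumes "open \<Omega>" "bounded \<Omega>" "compact T" and cf: "continuous_on (T \<times> closure \<Omega>) (\<lambda>(s, x). f s x)"
  shows "continuous_on T (\<lambda>s. \<integral>x. f s x \<partial>lebesgue_on \<Omega>)"
  unfolding continuous_on_sequentially
proof safe
  fix X s assume s: "s \<in> T" and X: "\<forall>n. X n \<in> T" "X \<longlonglongrightarrow> s"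
  note int = integrable_lebesgue_on_of_continuous_closure[OF assms(1,2)]
  have cont_s: "continuous_on (closure \<Omega>) (f r)" if "r \<in> T" for r
    by (rule continuous_on_slices(1)[OF cf that])
  have "compact (T \<times> closure \<Omega>)"
    using assms(2,3) by (intro compact_Times) (simp_all add: compact_closure)
  then obtain B where B0: "\<And>z. z \<in> T \<times> closure \<Omega> \<Longrightarrow> norm (case z of (s, x) \<Rightarrow> f s x) \<le> B"
    using continuous_on_compact_obtain_bound[OF _ cf] by blast
  have B: "\<bar>f s x\<bar> \<le> B" if "s \<in> T" "x \<in> closure \<Omega>" for s x
    using B0[of "(s, x)"] that by simp
  have "(\<lambda>n. \<integral>x. f (X n) x \<partial>lebesgue_on \<Omega>) \<longlonglongrightarrow> (\<integral>x. f s x \<partial>lebesgue_on \<Omega>)"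
  proof (rule integral_dominated_convergence)
    show "f s \<in> borel_measurable (lebesgue_on \<Omega>)" and "\<And>n. f (X n) \<in> borel_measurable (lebesgue_on \<Omega>)"
      using s X(1) by (auto intro!: borel_measurable_integrable[OF int] cont_s)
    show "integrable (lebesgue_on \<Omega>) (\<lambda>x. B)" by (rule int) (rule continuous_on_const)
    show "AE x in lebesgue_on \<Omega>. norm (f (X n) x) \<le> B" for n
      using B X(1) closure_subset[of \<Omega>] by (intro AE_I2) auto
    show "AE x in lebesgue_on \<Omega>. (\<lambda>n. f (X n) x) \<longlonglongrightarrow> f s x"
    proof (rule AE_I2)
      fix x assume "x \<in> space (lebesgue_on \<Omega>)"
      then have "x \<in> closure \<Omega>" using closure_subset by auto
      then have "continuous_on T (\<lambda>s. f s x)"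
        by (rule continuous_on_slices(2)[OF cf])
      then show "(\<lambda>n. f (X n) x) \<longlonglongrightarrow> f s x"
        using s X unfolding continuous_on_sequentially o_def by blast
    qed
  qed
  then show "((\<lambda>s. \<integral>x. f s x \<partial>lebesgue_on \<Omega>) \<circ> X) \<longlonglongrightarrow> (\<integral>x. f s x \<partial>lebesgue_on \<Omega>)"
    by (simp add: o_def)
qed

text \<open>If E t <= 0 there is nothing to show, as the right-hand side is nonnegative. Otherwise
  monotonicity keeps E positive on [0, t], which rules out E 0 = 0 and makes E^(-\<delta>)
  differentiable; E^(-\<delta>) - \<delta> k s is then nondecreasing in s.\<close>

lemma power_decay_of_differential_inequality:
  fixes E E' :: "real \<Rightarrow> real"
  assumes t: "0 \<le> t" and cE: "continuous_on {0..t} E"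
    and dE: "\<And>s. 0 < s \<Longrightarrow> (E has_real_derivative E' s) (at s)"
    and "\<And>s. 0 < s \<Longrightarrow> E' s \<le> 0"
    and decay: "\<And>s. 0 < s \<Longrightarrow> 0 < E s \<Longrightarrow> E' s \<le> - k * E s powr (1 + \<delta>)"
    and "0 < k" "0 < \<delta>"
  shows "E t \<le> (if E 0 = 0 then 0 else 1 / (\<delta> * k * t + E 0 powr (- \<delta>)) powr (1 / \<delta>))"
proof -
  have antimono: "E r \<le> E s" if "0 \<le> s" "s \<le> r" "r \<le> t" for s r
  proof (rule DERIV_nonpos_imp_decreasing_open[OF that(2)])
    show "continuous_on {s..r} E" by (rule continuous_on_subset[OF cE]) (use that in auto)
    show "\<exists>y. (E has_real_derivative y) (at x) \<and> y \<le> 0" if "s < x" "x < r" for x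
      using dE[of x] assms(4)[of x] that \<open>0 \<le> s\<close> by (intro exI[of _ "E' x"]) simp
  qed
  show ?thesis
  proof (cases "0 < E t")
    case False
    then show ?thesis by (auto intro: order_trans[of _ 0])
  next
    case True
    then have E_pos: "0 < E s" if "s \<in> {0..t}" for s using antimono[of s t] that by auto
    have "E 0 powr (- \<delta>) - \<delta> * k * 0 \<le> E t powr (- \<delta>) - \<delta> * k * t"
    proof (rule DERIV_nonneg_imp_increasing_open[OF t])
      show "continuous_on {0..t} (\<lambda>s. E s powr (- \<delta>) - \<delta> * k * s)"
        using E_pos by (intro continuous_intros cE) fastforce+
      fix s assume s: "0 < s" "s < t"
      then have Es: "0 < E s" using E_pos by auto
      have "((\<lambda>s. E s powr (- \<delta>)) has_real_derivative - \<delta> * E s powr (- \<delta> - 1) * E' s) (at s)"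
        using DERIV_chain2[OF has_real_derivative_powr[OF Es] dE[OF s(1)]] .
      then have "((\<lambda>s. E s powr (- \<delta>) - \<delta> * k * s) has_real_derivative
          - \<delta> * E s powr (- \<delta> - 1) * E' s - \<delta> * k) (at s)"
        by (rule DERIV_diff) (rule DERIV_cmult_Id)
      moreover have "0 \<le> - \<delta> * E s powr (- \<delta> - 1) * E' s - \<delta> * k"
      proof -
        have "\<delta> * E s powr (- \<delta> - 1) * E' s \<le> \<delta> * E s powr (- \<delta> - 1) * (- k * E s powr (1 + \<delta>))"
          using decay[OF s(1) Es] \<open>0 < \<delta>\<close> by (intro mult_left_mono) auto
        also have "\<dots> = - (\<delta> * k * (E s powr (- \<delta> - 1) * E s powr (1 + \<delta>)))" by simp
        also have "E s powr (- \<delta> - 1) * E s powr (1 + \<delta>) = 1"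
          using Es by (simp add: powr_add[symmetric])
        finally show ?thesis by simp
      qed
      ultimately show "\<exists>y. ((\<lambda>s. E s powr (- \<delta>) - \<delta> * k * s) has_real_derivative y) (at s) \<and> 0 \<le> y"
        by blast
    qed
    then have le: "\<delta> * k * t + E 0 powr (- \<delta>) \<le> E t powr (- \<delta>)" by simp
    have E0: "0 < E 0" using E_pos t by auto
    have pos: "0 < \<delta> * k * t + E 0 powr (- \<delta>)"
      using E0 t assms(6,7) by (intro add_nonneg_pos) auto
    have "(E t powr (- \<delta>)) powr (- (1 / \<delta>)) \<le> (\<delta> * k * t + E 0 powr (- \<delta>)) powr (- (1 / \<delta>))"
      using pos le \<open>0 < \<delta>\<close> by (intro powr_mono2') auto
    moreover have "(E t powr (- \<delta>)) powr (- (1 / \<delta>)) = E t"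
      using True \<open>0 < \<delta>\<close> by (simp add: powr_powr)
    ultimately show ?thesis using E0 by (simp add: powr_minus_divide)
  qed
qed

text \<open>The case distinction renders the convention for vanishing initial entropy: in HOL
  \<open>0 powr r\<close> is 0 for every r, so \<open>C\<^sub>2\<close> itself would be 0 and not
  infinite.\<close>

theorem theorem5:
  fixes \<Omega> :: "'a::euclidean_space set" and \<nu> :: "'a \<Rightarrow> 'a"
    and \<alpha> \<beta> C\<^sub>P p q C\<^sub>1 C\<^sub>2 t :: real
    and u0 :: "'a \<Rightarrow> real" and u :: "real \<Rightarrow> 'a \<Rightarrow> real"
  assumes "bounded_domain \<Omega>" and "measure lebesgue \<Omega> = 1"
    and "exterior_unit_normal_field \<Omega> \<nu>"
    and "C\<^sub>P > 0" and "poincare_wirtinger \<Omega> C\<^sub>P"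
    and "\<alpha> > 0" and "\<beta> > 1"
    and "bounded_nonneg_datum \<Omega> u0"
    and "smooth_positive_solution \<Omega> \<nu> \<beta> u0 u"
    and "p = (\<alpha> + \<beta>) / 2" and "q = 2 * (\<alpha> + 1) / (\<alpha> + \<beta>)"
    and "C\<^sub>1 = 4 * \<alpha> * \<beta> * (\<beta> - 1) / ((\<alpha> + 1) * (\<alpha> + \<beta>)\<^sup>2)
               * ((\<alpha> + 1) / beckner_const C\<^sub>P p q) powr ((\<alpha> + \<beta>) / (\<alpha> + 1))"
    and "C\<^sub>2 = entropy \<Omega> \<alpha> u0 powr (- ((\<beta> - 1) / (\<alpha> + 1)))"
    and "t \<ge> 0"
  shows "entropy \<Omega> \<alpha> (u t) \<le>
           (if entropy \<Omega> \<alpha> u0 = 0 then 0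
            else 1 / (C\<^sub>1 * t + C\<^sub>2) powr ((\<alpha> + 1) / (\<beta> - 1)))"
proof -
  have \<Omega>: "open \<Omega>" "bounded \<Omega>" using assms(1) by (auto simp: bounded_domain_def)
  have \<nu>: "exterior_unit_normal_at \<Omega> x (\<nu> x)" if "x \<in> frontier \<Omega>" for x
    using assms(3) that by (auto simp: exterior_unit_normal_field_def)
  have sol_smooth: "smooth_on ({0<..} \<times> closure \<Omega>) (\<lambda>(t, x). u t x)"
    and sol_cont: "continuous_on ({0..} \<times> closure \<Omega>) (\<lambda>(t, x). u t x)"
    and sol_pos: "\<And>s x. 0 < s \<Longrightarrow> x \<in> closure \<Omega> \<Longrightarrow> 0 < u s x"
    and sol_eq: "\<And>s x. 0 < s \<Longrightarrow> x \<in> \<Omega> \<Longrightarrow>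
        ((\<lambda>s. u s x) has_real_derivative laplacian (\<lambda>y. u s y powr \<beta>) x) (at s)"
    and sol_neumann: "\<And>s x. 0 < s \<Longrightarrow> x \<in> frontier \<Omega> \<Longrightarrow>
        gradient_within (\<lambda>y. u s y powr \<beta>) (closure \<Omega>) x \<bullet> \<nu> x = 0"
    and sol_init: "\<And>x. x \<in> \<Omega> \<Longrightarrow> u 0 x = u0 x"
    using assms(9) by (auto simp: smooth_positive_solution_def)
  obtain g H ut where du: "\<And>s x. 0 < s \<Longrightarrow> x \<in> closure \<Omega> \<Longrightarrow> (u s has_derivative (\<lambda>w. g s x \<bullet> w)) (at x within closure \<Omega>)"
    and dg: "\<And>s x. 0 < s \<Longrightarrow> x \<in> closure \<Omega> \<Longrightarrow> (g s has_derivative H s x) (at x within closure \<Omega>)"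
    and cH: "\<And>s w. 0 < s \<Longrightarrow> continuous_on (closure \<Omega>) (\<lambda>x. H s x w)"
    and dut: "\<And>s x. 0 < s \<Longrightarrow> x \<in> closure \<Omega> \<Longrightarrow> ((\<lambda>s. u s x) has_real_derivative ut s x) (at s)"
    and cut: "continuous_on ({0<..} \<times> closure \<Omega>) (\<lambda>(s, x). ut s x)"
    by (rule smooth_on_spacetime_derivatives[OF sol_smooth], rule that; (assumption | blast))
  have Osub: "\<Omega> \<subseteq> closure \<Omega>" by (rule closure_subset)
  have ut_eq: "ut s x = laplacian (\<lambda>y. u s y powr \<beta>) x" if "0 < s" "x \<in> \<Omega>" for s x
    using DERIV_unique[OF dut sol_eq] that Osub by blast
  have cu: "continuous_on (closure \<Omega>) (u s)" if "0 < s" for s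
    by (rule has_derivative_continuous_on[OF du[OF that]])
  have cg: "continuous_on (closure \<Omega>) (g s)" if "0 < s" for s
    by (rule has_derivative_continuous_on[OF dg[OF that]])
  have u_nz: "\<forall>x\<in>closure \<Omega>. u s x \<noteq> 0" if "0 < s" for s using sol_pos[OF that] by force
  \<comment> \<open>At time 0 the sign on the whole closure comes from the limit of positive values
    as s -> 0, since the datum is controlled only almost everywhere in \<Omega>.\<close>
  have u_nonneg: "0 \<le> u s x" if "0 \<le> s" "x \<in> closure \<Omega>" for s x
  proof (cases "s = 0")
    case True
    have "continuous_on {0..} (\<lambda>s. u s x)"
      by (rule continuous_on_slices(2)[OF sol_cont that(2)])
    then have "((\<lambda>s. u s x) \<longlongrightarrow> u 0 x) (at 0 within {0..})" by (simp add: continuous_on)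
    then have "((\<lambda>s. u s x) \<longlongrightarrow> u 0 x) (at_right 0)" by (rule tendsto_within_subset) auto
    moreover have "\<forall>\<^sub>F s in at_right 0. 0 \<le> u s x"
      using sol_pos that by (auto simp: eventually_at_filter less_imp_le)
    ultimately show ?thesis using True tendsto_lowerbound[of "\<lambda>s. u s x" "u 0 x" "at_right 0" 0] by simp
  next
    case False
    then show ?thesis using sol_pos[of s x] that by simp
  qed
  note int = integrable_lebesgue_on_of_continuous_closure[OF \<Omega>]
  have int_powr: "integrable (lebesgue_on \<Omega>) (\<lambda>x. u s x powr a)" if "0 < s" for s a
    by (intro int continuous_intros cu u_nz that)
  have measure_1: "measure (lebesgue_on \<Omega>) (space (lebesgue_on \<Omega>)) = 1"
    using assms(2) \<Omega> by (simp add: measure_restrict_space lmeasurable_open)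
  have mass_pos: "0 < (\<integral>x. u s x \<partial>lebesgue_on \<Omega>)" if "0 < s" for s
    using sol_pos[OF that] Osub measure_1 by (intro integral_pos_of_pos int cu that) auto

  \<comment> \<open>The weight a = 0 will give conservation of mass, a = \<alpha> the dissipation of
    entropy.\<close>
  have weighted: "(\<integral>x. u s x powr a * ut s x \<partial>lebesgue_on \<Omega>)
      = - (a * \<beta>) * (\<integral>x. u s x powr (a + \<beta> - 2) * (norm (g s x))\<^sup>2 \<partial>lebesgue_on \<Omega>)" if s: "0 < s" for s a
  proof -
    have "(\<integral>x. u s x powr a * ut s x \<partial>lebesgue_on \<Omega>)
        = (\<integral>x. u s x powr a * laplacian (\<lambda>y. u s y powr \<beta>) x \<partial>lebesgue_on \<Omega>)"
      by (intro Bochner_Integration.integral_cong) (auto simp: ut_eq[OF s])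
    also have "\<dots> = - (a * \<beta>) * (\<integral>x. u s x powr (a + \<beta> - 2) * (norm (g s x))\<^sup>2 \<partial>lebesgue_on \<Omega>)"
      by (rule integral_powr_mult_laplacian_powr[where H = "H s" and \<nu> = \<nu>])
        (use \<Omega> \<nu> sol_pos du dg cH sol_neumann s \<open>1 < \<beta>\<close> in auto)
    finally show ?thesis .
  qed
  have d_mass: "((\<lambda>s. \<integral>x. u s x \<partial>lebesgue_on \<Omega>) has_real_derivative 0) (at s)" if s: "0 < s" for s
  proof -
    have "((\<lambda>s. \<integral>x. u s x \<partial>lebesgue_on \<Omega>) has_real_derivative (\<integral>x. ut s x \<partial>lebesgue_on \<Omega>)) (at s)"
      by (rule has_real_derivative_integral_lebesgue_on) (use \<Omega> s cu dut Osub cut in auto)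
    \<comment> \<open>Writing 1 as \<open>u s x powr 0\<close> uses positivity, since
      \<open>0 powr 0\<close> is 0 in HOL.\<close>
    also have "(\<integral>x. ut s x \<partial>lebesgue_on \<Omega>) = (\<integral>x. u s x powr 0 * ut s x \<partial>lebesgue_on \<Omega>)"
      using u_nz[OF s] Osub by (intro Bochner_Integration.integral_cong) auto
    finally show ?thesis using weighted[OF s, of 0] by simp
  qed
  have d_power: "((\<lambda>s. \<integral>x. u s x powr (\<alpha> + 1) \<partial>lebesgue_on \<Omega>) has_real_derivative
      (\<integral>x. (\<alpha> + 1) * (u s x powr \<alpha> * ut s x) \<partial>lebesgue_on \<Omega>)) (at s)" if s: "0 < s" for s
  proof (rule has_real_derivative_integral_lebesgue_on[OF \<Omega> s])
    show "continuous_on (closure \<Omega>) (\<lambda>x. u r x powr (\<alpha> + 1))" if "0 < r" for r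
      by (intro continuous_intros cu u_nz that)
    show "((\<lambda>s. u s x powr (\<alpha> + 1)) has_real_derivative (\<alpha> + 1) * (u r x powr \<alpha> * ut r x)) (at r)"
      if r: "0 < r" and x: "x \<in> \<Omega>" for r x
    proof -
      have xc: "x \<in> closure \<Omega>" using x Osub by auto
      show ?thesis
        using DERIV_chain2[OF has_real_derivative_powr[OF sol_pos[OF r xc], of "\<alpha> + 1"] dut[OF r xc]]
        by (simp add: mult.assoc)
    qed
    have "continuous_on ({0<..} \<times> closure \<Omega>) (\<lambda>z. (\<alpha> + 1) * ((case z of (s, x) \<Rightarrow> u s x) powr \<alpha> * (case z of (s, x) \<Rightarrow> ut s x)))"
      by (intro continuous_intros continuous_on_subset[OF sol_cont] cut) (use u_nz in fastforce)+
    then show "continuous_on ({0<..} \<times> closure \<Omega>) (\<lambda>(s, x). (\<alpha> + 1) * (u s x powr \<alpha> * ut s x))"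
      by (simp add: split_def)
  qed

  define dis where "dis s = (\<integral>x. u s x powr (\<alpha> + \<beta> - 2) * (norm (g s x))\<^sup>2 \<partial>lebesgue_on \<Omega>)" for s
  have dis_nonneg: "0 \<le> dis s" for s unfolding dis_def by (intro integral_nonneg_AE AE_I2) auto
  define E where "E s = entropy \<Omega> \<alpha> (u s)" for s
  have E_eq: "E = (\<lambda>s. 1 / (\<alpha> + 1) * ((\<integral>x. u s x powr (\<alpha> + 1) \<partial>lebesgue_on \<Omega>)
      - (\<integral>x. u s x \<partial>lebesgue_on \<Omega>) powr (\<alpha> + 1)))"
    by (rule ext) (simp only: E_def entropy_def)
  have dE: "(E has_real_derivative - (\<alpha> * \<beta>) * dis s) (at s)" if s: "0 < s" for s
  proof -
    have "((\<lambda>s. (\<integral>x. u s x \<partial>lebesgue_on \<Omega>) powr (\<alpha> + 1)) has_real_derivative 0) (at s)"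
      using DERIV_chain2[OF has_real_derivative_powr[OF mass_pos[OF s]] d_mass[OF s]] by simp
    from DERIV_cmult[OF DERIV_diff[OF d_power[OF s] this], of "1 / (\<alpha> + 1)"]
    have "(E has_real_derivative 1 / (\<alpha> + 1) * (\<integral>x. (\<alpha> + 1) * (u s x powr \<alpha> * ut s x) \<partial>lebesgue_on \<Omega>)) (at s)"
      unfolding E_eq diff_0_right .
    also have "1 / (\<alpha> + 1) * (\<integral>x. (\<alpha> + 1) * (u s x powr \<alpha> * ut s x) \<partial>lebesgue_on \<Omega>)
        = (\<integral>x. u s x powr \<alpha> * ut s x \<partial>lebesgue_on \<Omega>)"
      using \<open>0 < \<alpha>\<close> by simp
    also have "\<dots> = - (\<alpha> * \<beta>) * dis s" unfolding weighted[OF s] dis_def by simp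
    finally show ?thesis .
  qed
  \<comment> \<open>At time 0 the base of \<open>powr\<close> may vanish. Continuity survives
    because the base is nonnegative and the exponent \<alpha> + 1 is positive.\<close>
  have cE: "continuous_on {0..t} E"
  proof -
    have sub: "{0..t} \<times> closure \<Omega> \<subseteq> {0..} \<times> closure \<Omega>" by auto
    have "continuous_on ({0..t} \<times> closure \<Omega>) (\<lambda>z. (case z of (s, x) \<Rightarrow> u s x) powr (\<alpha> + 1))"
      using u_nonneg \<open>0 < \<alpha>\<close> by (intro continuous_on_powr' continuous_on_subset[OF sol_cont sub] continuous_on_const) auto
    then have "continuous_on ({0..t} \<times> closure \<Omega>) (\<lambda>(s, x). u s x powr (\<alpha> + 1))"
      by (simp add: split_def)
    then have "continuous_on {0..t} (\<lambda>s. \<integral>x. u s x powr (\<alpha> + 1) \<partial>lebesgue_on \<Omega>)"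
      by (rule continuous_on_integral_lebesgue_on[OF \<Omega> compact_Icc])
    moreover have "continuous_on {0..t} (\<lambda>s. \<integral>x. u s x \<partial>lebesgue_on \<Omega>)"
      by (rule continuous_on_integral_lebesgue_on[OF \<Omega> compact_Icc continuous_on_subset[OF sol_cont sub]])
    then have "continuous_on {0..t} (\<lambda>s. (\<integral>x. u s x \<partial>lebesgue_on \<Omega>) powr (\<alpha> + 1))"
    proof (rule continuous_on_powr'[OF _ continuous_on_const], intro ballI)
      fix s assume "s \<in> {0..t}"
      then have "0 \<le> (\<integral>x. u s x \<partial>lebesgue_on \<Omega>)"
        using u_nonneg Osub by (intro integral_nonneg_AE AE_I2) auto
      then show "0 \<le> (\<integral>x. u s x \<partial>lebesgue_on \<Omega>) \<and> ((\<integral>x. u s x \<partial>lebesgue_on \<Omega>) = 0 \<longrightarrow> 0 < \<alpha> + 1)"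
        using \<open>0 < \<alpha>\<close> by simp
    qed
    ultimately show ?thesis
      unfolding E_def entropy_def by (intro continuous_on_mult continuous_on_diff continuous_on_const)
  qed
  have E0: "E 0 = entropy \<Omega> \<alpha> u0"
  proof -
    have "(\<integral>x. u 0 x powr (\<alpha> + 1) \<partial>lebesgue_on \<Omega>) = (\<integral>x. u0 x powr (\<alpha> + 1) \<partial>lebesgue_on \<Omega>)"
      "(\<integral>x. u 0 x \<partial>lebesgue_on \<Omega>) = (\<integral>x. u0 x \<partial>lebesgue_on \<Omega>)"
      by (intro Bochner_Integration.integral_cong refl; simp add: sol_init)+
    then show ?thesis by (simp add: E_def entropy_def)
  qed

  define \<gamma> where "\<gamma> = (\<alpha> + \<beta>) / (\<alpha> + 1)"
  define B where "B = beckner_const C\<^sub>P p q"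
  \<comment> \<open>Identifies the numerator 2 (p q - 1) of the Beckner constant as 2 \<alpha>, so
    \<open>B\<close> is the factor from the moment inequality times
    \<open>C\<^sub>P powr q\<close>.\<close>
  have pq: "p * q = \<alpha> + 1"
    using \<open>0 < \<alpha>\<close> \<open>1 < \<beta>\<close> unfolding assms(10,11) by (simp add: divide_simps) (simp add: algebra_simps)
  have p: "2 * p = \<alpha> + \<beta>" "0 < p" using assms(6,7,10) by auto
  have q: "0 < q" "q < 2" using assms(6,7) by (auto simp: assms(11) divide_simps)
  have q\<gamma>: "2 / q = \<gamma>"
    unfolding assms(11) \<gamma>_def divide_divide_eq_right by (rule mult_divide_mult_cancel_left) simp
  have B: "B = 2 * \<alpha> / (2 - q) * C\<^sub>P powr q" by (simp add: B_def beckner_const_def pq)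
  have B_pos: "0 < B" using q assms(4,6) by (simp add: B)
  have dissipation: "((\<alpha> + 1) * E s / B) powr \<gamma> \<le> p\<^sup>2 * dis s" if s: "0 < s" and Es: "0 < E s" for s
  proof -
    \<comment> \<open>The gradient of u^p. Its squared norm carries the weight u^(2 p - 2), and 2 p
      - 2 = \<alpha> + \<beta> - 2 is the exponent in \<open>dis\<close>.\<close>
    define G where "G x = (p * u s x powr (p - 1)) *\<^sub>R g s x" for x
    have variance: "(\<integral>x. (u s x powr p)\<^sup>2 \<partial>lebesgue_on \<Omega>) - (\<integral>x. u s x powr p \<partial>lebesgue_on \<Omega>)\<^sup>2
        \<le> C\<^sub>P\<^sup>2 * (\<integral>x. (norm (G x))\<^sup>2 \<partial>lebesgue_on \<Omega>)"
    proof (rule poincare_wirtinger_variance[where \<nu> = \<nu>])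
      fix x assume x: "x \<in> closure \<Omega>"
      show "((\<lambda>x. u s x powr p) has_derivative (\<lambda>w. G x \<bullet> w)) (at x within closure \<Omega>)"
        using has_derivative_powr_const[OF du sol_pos, OF s x s x, of p] by (simp add: G_def)
    next
      show "continuous_on (closure \<Omega>) G"
        unfolding G_def by (intro continuous_intros cu cg u_nz s)
    qed (use \<Omega> \<nu> assms in auto)
    have sq: "(u s x powr a)\<^sup>2 = u s x powr (2 * a)" for x a
      by (simp add: power2_eq_square powr_add[symmetric])
    have "(norm (G x))\<^sup>2 = p\<^sup>2 * (u s x powr (\<alpha> + \<beta> - 2) * (norm (g s x))\<^sup>2)" for x
      using p by (simp add: G_def power_mult_distrib sq right_diff_distrib)
    then have "(\<integral>x. u s x powr (\<alpha> + \<beta>) \<partial>lebesgue_on \<Omega>) - (\<integral>x. u s x powr p \<partial>lebesgue_on \<Omega>)\<^sup>2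
        \<le> C\<^sub>P\<^sup>2 * (p\<^sup>2 * dis s)"
      using variance by (simp add: sq p dis_def)
    then have "(\<integral>x. u s x powr (\<alpha> + 1) \<partial>lebesgue_on \<Omega>) - (\<integral>x. u s x \<partial>lebesgue_on \<Omega>) powr (\<alpha> + 1)
        \<le> 2 * \<alpha> / (2 - q) * (C\<^sub>P\<^sup>2 * (p\<^sup>2 * dis s)) powr (q / 2)"
    proof (rule beckner_inequality[OF measure_1 assms(6,7) _ int_powr[OF s] assms(10,11), rotated])
      show "0 < u s x" if "x \<in> space (lebesgue_on \<Omega>)" for x using sol_pos[OF s] that Osub by auto
    qed
    also have "(C\<^sub>P\<^sup>2 * (p\<^sup>2 * dis s)) powr (q / 2) = (C\<^sub>P\<^sup>2) powr (q / 2) * (p\<^sup>2 * dis s) powr (q / 2)"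
      by (rule powr_mult)
    also have "(C\<^sub>P\<^sup>2) powr (q / 2) = C\<^sub>P powr q"
    proof -
      have "C\<^sub>P\<^sup>2 = C\<^sub>P powr 2" using \<open>0 < C\<^sub>P\<close> by simp
      then have "(C\<^sub>P\<^sup>2) powr (q / 2) = C\<^sub>P powr (2 * (q / 2))" by (simp only: powr_powr)
      then show ?thesis by simp
    qed
    finally have "(\<alpha> + 1) * E s \<le> B * (p\<^sup>2 * dis s) powr (q / 2)"
      using \<open>0 < \<alpha>\<close> by (simp add: E_def entropy_def B mult.assoc)
    then have "(\<alpha> + 1) * E s / B \<le> (p\<^sup>2 * dis s) powr (q / 2)"
      using B_pos by (simp add: divide_le_eq mult.commute)
    then have "((\<alpha> + 1) * E s / B) powr (2 / q) \<le> ((p\<^sup>2 * dis s) powr (q / 2)) powr (2 / q)"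
      using B_pos Es q \<open>0 < \<alpha>\<close> by (intro powr_mono2) auto
    also have "\<dots> = p\<^sup>2 * dis s" using q(1) dis_nonneg[of s] by (simp add: powr_powr)
    finally show ?thesis by (simp only: q\<gamma>)
  qed
  \<comment> \<open>The prefactor is \<alpha> \<beta> / p^2, from E' = -\<alpha> \<beta> dis and the
    lower bound for p^2 dis; the remaining factor is what that bound leaves when E^\<gamma> is split
    off. With \<delta> = \<gamma> - 1 the product \<delta> k is \<open>C\<^sub>1\<close>.\<close>
  define k where "k = 4 * \<alpha> * \<beta> / (\<alpha> + \<beta>)\<^sup>2 * ((\<alpha> + 1) / B) powr \<gamma>"
  define \<delta> where "\<delta> = (\<beta> - 1) / (\<alpha> + 1)"
  have \<gamma>: "\<gamma> = 1 + \<delta>" using \<open>0 < \<alpha>\<close> by (simp add: \<gamma>_def \<delta>_def add_divide_distrib[symmetric] field_simps)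
  have "E t \<le> (if E 0 = 0 then 0 else 1 / (\<delta> * k * t + E 0 powr (- \<delta>)) powr (1 / \<delta>))"
  proof (rule power_decay_of_differential_inequality[OF \<open>t \<ge> 0\<close> cE dE])
    show "0 < \<delta>" "0 < k" using B_pos assms(6,7) by (auto simp: \<delta>_def k_def)
    show "- (\<alpha> * \<beta>) * dis s \<le> 0" for s using dis_nonneg[of s] assms(6,7) by simp
    show "- (\<alpha> * \<beta>) * dis s \<le> - k * E s powr (1 + \<delta>)" if s: "0 < s" and Es: "0 < E s" for s
    proof -
      have "k * E s powr \<gamma> = 4 * \<alpha> * \<beta> / (\<alpha> + \<beta>)\<^sup>2 * ((\<alpha> + 1) * E s / B) powr \<gamma>"
        using Es B_pos \<open>0 < \<alpha>\<close> by (simp add: k_def powr_mult powr_divide)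
      also have "\<dots> \<le> 4 * \<alpha> * \<beta> / (\<alpha> + \<beta>)\<^sup>2 * (p\<^sup>2 * dis s)"
        using assms(6,7) by (intro mult_left_mono dissipation s Es) auto
      also have "\<dots> = \<alpha> * \<beta> * dis s"
        using assms(6,7) by (simp add: assms(10) power_divide)
      finally show ?thesis by (simp add: \<gamma>)
    qed
  qed
  moreover have "\<delta> * k = C\<^sub>1"
    unfolding \<delta>_def k_def assms(12) B_def[symmetric] \<gamma>_def[symmetric] by (simp add: mult_ac)
  moreover have "E 0 powr (- \<delta>) = C\<^sub>2" by (simp add: E0 assms(13) \<delta>_def)
  moreover have "1 / \<delta> = (\<alpha> + 1) / (\<beta> - 1)" by (simp add: \<delta>_def)
  ultimately have "E t \<le> (if E 0 = 0 then 0 else 1 / (C\<^sub>1 * t + C\<^sub>2) powr ((\<alpha> + 1) / (\<beta> - 1)))"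
    by (simp only:)
  then show ?thesis unfolding E0 unfolding E_def .
qed

end
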